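(* For every integer $n\ge 1$, the number $\beta(n)$ of orbits of the action on $X_n$ (the set of $n\times n$ matrices with entries in $\{0,1\}$) of the group generated by row rotation $\sigma$, column rotation $\tau$, row reflection $\rho$, column reflection $\theta$, and matrix transposition $\zeta$ is $$ \beta(n)=\frac{1}{2}\,b(n,n)+\frac{1}{4n}\sum_{d\,|\,n}\varphi(d)\,2^{\,n(n+d-2\lfloor d/2\rfloor)/(2d)}+\begin{cases}2^{(n^2-5)/4},&\text{if $n$ is odd;}\\ 5\cdot 2^{n^2/4-3},&\text{if $n$ is even,}\end{cases} $$ where $b(m,n)$ is the explicit function of positive integers $m,n$ defined in the context.
   Context: $X_n:=\{0,1\}^{\{0,1,\ldots,n-1\}^2}$ is the set of $n\times n$ matrices of 0s and 1s, with rows and columns indexed by $0,1,\ldots,n-1$. The following permutations act on $X_n$ by permuting the positions of the entries: $\sigma$ rotates the rows (row 0 becomes row 1, row 1 becomes row 2, ..., row $n-1$ becomes row 0); $\tau$ rotates the columns in the same way; $\rho$ reflects the rows (rows $0$ and $n-1$ are interchanged, rows $1$ and $n-2$ are interchanged, ..., rows $\lfloor n/2\rfloor-1$ and $n-\lfloor n/2\rfloor$ are interchanged); $\theta$ reflects the columns in the same way; $\zeta$ transposes the matrix. Informally, $\beta(n)$ is the number of distinct toroidal $n\times n$ binary arrays, allowing rotation and/or reflection of rows and/or columns as well as matrix transposition. Here $\varphi$ is Euler's phi function, $\operatorname{lcm}$ is the least common multiple, and sums over $d\,|\,n$ run over the positive divisors of $n$. For positive integers $m,n$ define $$b(m,n):=b_1(m,n)+b_2(m,n)+b_3(m,n)+b_4(m,n),$$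 where $$b_1(m,n):=\frac{1}{4mn}\sum_{c\,|\,m}\;\sum_{d\,|\,n}\varphi(c)\varphi(d)\,2^{mn/\operatorname{lcm}(c,d)},$$ $$b_2(m,n):=\frac{1}{4n}\sum_{d\,|\,n}\varphi(d)\,2^{mn/d}+\begin{cases}\dfrac{1}{4n}\displaystyle\sum_{d\,|\,n:\ d\text{ odd}}\varphi(d)\bigl(2^{(m+1)n/(2d)}-2^{mn/d}\bigr),&\text{if $m$ is odd;}\\[2ex] \dfrac{1}{8n}\displaystyle\sum_{d\,|\,n:\ d\text{ odd}}\varphi(d)\bigl(2^{mn/(2d)}+2^{(m+2)n/(2d)}-2\cdot 2^{mn/d}\bigr),&\text{if $m$ is even,}\end{cases}$$ $$b_3(m,n):=b_2(n,m),$$ $$b_4(m,n):=\begin{cases}2^{(mn-3)/2},&\text{if $m$ and $n$ are odd;}\\ 3\cdot 2^{mn/2-3},&\text{if $m$ and $n$ have opposite parity;}\\ 7\cdot 2^{mn/2-4},&\text{if $m$ and $n$ are even.}\end{cases}$$ *)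

theory Defs
  imports "HOL-Algebra.Algebra" "HOL-Number_Theory.Totient"
begin

abbreviation positions :: "nat \<Rightarrow> (nat \<times> nat) set"
  where "positions n \<equiv> {..<n} \<times> {..<n}"

definition binary_matrices :: "nat \<Rightarrow> (nat \<times> nat \<Rightarrow> nat) set"
  where "binary_matrices n = positions n \<rightarrow>\<^sub>E {0, 1}"

text \<open>
  Entry \<open>(i, j)\<close> of the image is the entry of the argument that is moved to \<open>(i, j)\<close>.
  Row \<open>k\<close> becomes row \<open>k + 1\<close> under the rotation, so row \<open>i\<close> of the image is
  row \<open>i - 1\<close> modulo \<open>n\<close> of the argument. The offset \<open>n - 1\<close> avoids truncated subtraction.
\<close>

definition row_rotation :: "nat \<Rightarrow> (nat \<times> nat \<Rightarrow> nat) \<Rightarrow> nat \<times> nat \<Rightarrow> nat"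
  where "row_rotation n =
    (\<lambda>A\<in>binary_matrices n. \<lambda>(i, j)\<in>positions n. A ((i + (n - 1)) mod n, j))"

definition column_rotation :: "nat \<Rightarrow> (nat \<times> nat \<Rightarrow> nat) \<Rightarrow> nat \<times> nat \<Rightarrow> nat"
  where "column_rotation n =
    (\<lambda>A\<in>binary_matrices n. \<lambda>(i, j)\<in>positions n. A (i, (j + (n - 1)) mod n))"

definition row_reflection :: "nat \<Rightarrow> (nat \<times> nat \<Rightarrow> nat) \<Rightarrow> nat \<times> nat \<Rightarrow> nat"
  where "row_reflection n =
    (\<lambda>A\<in>binary_matrices n. \<lambda>(i, j)\<in>positions n. A (n - 1 - i, j))"

definition column_reflection :: "nat \<Rightarrow> (nat \<times> nat \<Rightarrow> nat) \<Rightarrow> nat \<times> nat \<Rightarrow> nat"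
  where "column_reflection n =
    (\<lambda>A\<in>binary_matrices n. \<lambda>(i, j)\<in>positions n. A (i, n - 1 - j))"

definition transposition :: "nat \<Rightarrow> (nat \<times> nat \<Rightarrow> nat) \<Rightarrow> nat \<times> nat \<Rightarrow> nat"
  where "transposition n =
    (\<lambda>A\<in>binary_matrices n. \<lambda>(i, j)\<in>positions n. A (j, i))"

definition toroidal_generators :: "nat \<Rightarrow> ((nat \<times> nat \<Rightarrow> nat) \<Rightarrow> nat \<times> nat \<Rightarrow> nat) set"
  where "toroidal_generators n =
    {row_rotation n, column_rotation n, row_reflection n, column_reflection n, transposition n}"

definition toroidal_group :: "nat \<Rightarrow> ((nat \<times> nat \<Rightarrow> nat) \<Rightarrow> nat \<times> nat \<Rightarrow> nat) monoid"
  where "toroidal_group n =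
    (BijGroup (binary_matrices n))
      \<lparr>carrier := generate (BijGroup (binary_matrices n)) (toroidal_generators n)\<rparr>"

definition toroidal_beta :: "nat \<Rightarrow> nat"
  where "toroidal_beta n = card (orbits (toroidal_group n) (binary_matrices n) (\<lambda>g. g))"

text \<open>
  The operators are permutations of the set of binary matrices, so that the generated
  subgroup of the symmetric group on that set is meaningful and does act on it.
\<close>

lemma reindex_Bij:
  assumes p: "\<And>x. x \<in> positions n \<Longrightarrow> p x \<in> positions n"
    and q: "\<And>x. x \<in> positions n \<Longrightarrow> q x \<in> positions n"
    and pq: "\<And>x. x \<in> positions n \<Longrightarrow> p (q x) = x"
    and qp: "\<And>x. x \<in> positions n \<Longrightarrow> q (p x) = x"
  shows "(\<lambda>A\<in>binary_matrices n. \<lambda>x\<in>positions n. A (p x)) \<in> Bij (binary_matrices n)"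
proof -
  have "bij_betw (\<lambda>A. \<lambda>x\<in>positions n. A (p x)) (binary_matrices n) (binary_matrices n)"
  proof (rule bij_betwI[where g = "\<lambda>A. \<lambda>x\<in>positions n. A (q x)"])
    show "(\<lambda>A. \<lambda>x\<in>positions n. A (p x)) \<in> binary_matrices n \<rightarrow> binary_matrices n"
    proof (rule funcsetI)
      fix A assume "A \<in> binary_matrices n"
      then show "(\<lambda>x\<in>positions n. A (p x)) \<in> binary_matrices n"
        unfolding binary_matrices_def restrict_PiE_iff using p PiE_mem by metis
    qed
    show "(\<lambda>A. \<lambda>x\<in>positions n. A (q x)) \<in> binary_matrices n \<rightarrow> binary_matrices n"
    proof (rule funcsetI)
      fix A assume "A \<in> binary_matrices n"
      then show "(\<lambda>x\<in>positions n. A (q x)) \<in> binary_matrices n"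
        unfolding binary_matrices_def restrict_PiE_iff using q PiE_mem by metis
    qed
  next
    fix A assume A: "A \<in> binary_matrices n"
    then have ext: "A \<in> extensional (positions n)"
      unfolding binary_matrices_def by (simp add: PiE_def)
    show "(\<lambda>x\<in>positions n. (\<lambda>x\<in>positions n. A (p x)) (q x)) = A"
      by (rule extensionalityI[OF restrict_extensional ext]) (simp only: restrict_apply' q pq)
    show "(\<lambda>x\<in>positions n. (\<lambda>x\<in>positions n. A (q x)) (p x)) = A"
      by (rule extensionalityI[OF restrict_extensional ext]) (simp only: restrict_apply' p qp)
  qed
  then show ?thesis
    unfolding Bij_def by (simp only: bij_betw_restrict_eq restrict_extensional Int_iff mem_Collect_eq simp_thms)
qed

lemma toroidal_generators_subset:
  "toroidal_generators n \<subseteq> carrier (BijGroup (binary_matrices n))"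
proof -
  have a: "((i + n - 1) mod n + 1) mod n = i" "((i + 1) mod n + n - 1) mod n = i"
    if "i < n" for i
  proof -
    show "((i + n - 1) mod n + 1) mod n = i"
      using that by (simp add: mod_add_left_eq del: One_nat_def)
    show "((i + 1) mod n + n - 1) mod n = i"
      using that by (cases "i + 1 = n") auto
  qed
  have "row_rotation n \<in> Bij (binary_matrices n)"
  proof -
    have "(\<lambda>A\<in>binary_matrices n. \<lambda>x\<in>positions n. A ((\<lambda>(i, j). ((i + (n - 1)) mod n, j)) x)) \<in> Bij (binary_matrices n)"
      by (rule reindex_Bij[where q = "\<lambda>(i, j). ((i + 1) mod n, j)"]) (auto simp: a simp del: One_nat_def)
    then show ?thesis
      unfolding row_rotation_def by (simp only: case_prod_unfold fst_conv snd_conv)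
  qed
  moreover have "column_rotation n \<in> Bij (binary_matrices n)"
  proof -
    have "(\<lambda>A\<in>binary_matrices n. \<lambda>x\<in>positions n. A ((\<lambda>(i, j). (i, (j + (n - 1)) mod n)) x)) \<in> Bij (binary_matrices n)"
      by (rule reindex_Bij[where q = "\<lambda>(i, j). (i, (j + 1) mod n)"]) (auto simp: a simp del: One_nat_def)
    then show ?thesis
      unfolding column_rotation_def by (simp only: case_prod_unfold fst_conv snd_conv)
  qed
  moreover have "row_reflection n \<in> Bij (binary_matrices n)"
  proof -
    have "(\<lambda>A\<in>binary_matrices n. \<lambda>x\<in>positions n. A ((\<lambda>(i, j). (n - 1 - i, j)) x)) \<in> Bij (binary_matrices n)"
      by (rule reindex_Bij[where q = "\<lambda>(i, j). (n - 1 - i, j)"]) (auto simp: a simp del: One_nat_def)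
    then show ?thesis
      unfolding row_reflection_def by (simp only: case_prod_unfold fst_conv snd_conv)
  qed
  moreover have "column_reflection n \<in> Bij (binary_matrices n)"
  proof -
    have "(\<lambda>A\<in>binary_matrices n. \<lambda>x\<in>positions n. A ((\<lambda>(i, j). (i, n - 1 - j)) x)) \<in> Bij (binary_matrices n)"
      by (rule reindex_Bij[where q = "\<lambda>(i, j). (i, n - 1 - j)"]) (auto simp: a simp del: One_nat_def)
    then show ?thesis
      unfolding column_reflection_def by (simp only: case_prod_unfold fst_conv snd_conv)
  qed
  moreover have "transposition n \<in> Bij (binary_matrices n)"
  proof -
    have "(\<lambda>A\<in>binary_matrices n. \<lambda>x\<in>positions n. A ((\<lambda>(i, j). (j, i)) x)) \<in> Bij (binary_matrices n)"
      by (rule reindex_Bij[where q = "\<lambda>(i, j). (j, i)"]) (auto simp: a simp del: One_nat_def)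
    then show ?thesis
      unfolding transposition_def by (simp only: case_prod_unfold fst_conv snd_conv)
  qed
  ultimately show ?thesis
    by (simp add: toroidal_generators_def BijGroup_def)
qed

lemma toroidal_group_action:
  "group_action (toroidal_group n) (binary_matrices n) (\<lambda>g. g)"
proof -
  interpret B: group "BijGroup (binary_matrices n)" by (rule group_BijGroup)
  have sub: "subgroup (generate (BijGroup (binary_matrices n)) (toroidal_generators n))
      (BijGroup (binary_matrices n))"
    by (rule B.generate_is_subgroup[OF toroidal_generators_subset])
  have "group (toroidal_group n)"
    unfolding toroidal_group_def by (rule B.subgroup_imp_group[OF sub])
  then show ?thesis
    unfolding group_action_def group_hom_def group_hom_axioms_def
    using subgroup.subset[OF sub]
    by (auto simp: hom_def toroidal_group_def group_BijGroup)
qed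

definition b1 :: "nat \<Rightarrow> nat \<Rightarrow> real"
  where "b1 m n = 1 / (4 * real m * real n) *
    (\<Sum>c | c dvd m. \<Sum>d | d dvd n.
      real (totient c) * real (totient d) * 2 powr (real m * real n / real (lcm c d)))"

definition b2 :: "nat \<Rightarrow> nat \<Rightarrow> real"
  where "b2 m n =
    1 / (4 * real n) * (\<Sum>d | d dvd n. real (totient d) * 2 powr (real m * real n / real d)) +
    (if odd m then
       1 / (4 * real n) * (\<Sum>d | d dvd n \<and> odd d. real (totient d) *
         (2 powr ((real m + 1) * real n / (2 * real d)) - 2 powr (real m * real n / real d)))
     else
       1 / (8 * real n) * (\<Sum>d | d dvd n \<and> odd d. real (totient d) *
         (2 powr (real m * real n / (2 * real d)) + 2 powr ((real m + 2) * real n / (2 * real d))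
           - 2 * 2 powr (real m * real n / real d))))"

definition b3 :: "nat \<Rightarrow> nat \<Rightarrow> real"
  where "b3 m n = b2 n m"

definition b4 :: "nat \<Rightarrow> nat \<Rightarrow> real"
  where "b4 m n =
    (if odd m \<and> odd n then 2 powr ((real m * real n - 3) / 2)
     else if even m \<and> even n then 7 * 2 powr (real m * real n / 2 - 4)
     else 3 * 2 powr (real m * real n / 2 - 3))"

definition toroidal_b :: "nat \<Rightarrow> nat \<Rightarrow> real"
  where "toroidal_b m n = b1 m n + b2 m n + b3 m n + b4 m n"

end

theory Submission
  imports Defs
begin

text \<open>
  Every element of the group moves the entry positions by an affine map
  \<open>(x, y) \<mapsto> (e x + a, d y + b)\<close> or \<open>(x, y) \<mapsto> (e y + a, d x + b)\<close> of the torus, with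
  signs \<open>e\<close>, \<open>d\<close> and \<open>a\<close>, \<open>b\<close> modulo \<open>n\<close>. For \<open>n \<le> 2\<close> different parameters can give
  the same permutation, but each permutation arises equally often, so Burnside's lemma may be
  summed over the \<open>8n\<^sup>2\<close> parameters. A map fixes \<open>2\<^sup>c\<close> matrices, where the number \<open>c\<close> of its
  cycles is the sum over all positions of the reciprocal of the period of the position. The
  periods depend only on additive orders modulo \<open>n\<close>, each order \<open>d\<close> being taken by \<open>\<phi>(d)\<close>
  residues, and on the number of solutions of \<open>2x = a\<close> modulo \<open>n\<close>.
\<close>

section \<open>Functions invariant under a permutation\<close>

text \<open>The parameters cover the group evenly because right multiplication by a generator lifts
  to a bijection of the parameters; the order of the group is never computed. Nor are cycles listed:
  a period is pinned down by a divisibility test, the \<open>k\<close>-th iterate returning to a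
  point iff the period divides \<open>k\<close>, and this test is checked with integer formulas for
  the iterates. The eight families given by \<open>t\<close>, \<open>e\<close>, \<open>d\<close>
  match the terms of the formula. The four without transposition are translations
  (\<open>b1\<close>), row and column reflections (\<open>b2\<close>, \<open>b3\<close>) and half
  turns (\<open>b4\<close>); they make up half of the parameters, hence the factor 1/2.
  Transposition with equal signs is a glide reflection along a diagonal and gives the divisor sum;
  with opposite signs it is a quarter turn and gives the last term.\<close>

lemma sum_card_fibre:
  fixes g :: "'b \<Rightarrow> 'c::comm_semiring_1"
  assumes "finite A" "finite B" "f ` A \<subseteq> B" "\<And>y. y \<in> B \<Longrightarrow> card {x \<in> A. f x = y} = k"
  shows "(\<Sum>x\<in>A. g (f x)) = of_nat k * (\<Sum>y\<in>B. g y)"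
proof -
  have "(\<Sum>x\<in>A. g (f x)) = (\<Sum>y\<in>B. \<Sum>x\<in>{x \<in> A. f x = y}. g (f x))"
    by (rule sum.group[symmetric]) (use assms in auto)
  also have "\<dots> = (\<Sum>y\<in>B. of_nat k * g y)"
    by (rule sum.cong) (use assms in auto)
  finally show ?thesis by (simp add: sum_distrib_left)
qed

text \<open>A cycle has as many points as the period of each of them, so their reciprocals sum to 1,
  and an invariant function is a free choice of one value per cycle. Bijectivity of \<open>f\<close>
  is implicit in the returns that \<open>pos\<close> and \<open>period\<close> provide.\<close>

lemma card_cycle_invariant_functions:
  fixes f :: "'a \<Rightarrow> 'a" and S :: "'a set" and N :: "'a \<Rightarrow> nat"
  assumes fin: "finite S" and maps: "\<And>x. x \<in> S \<Longrightarrow> f x \<in> S"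
    and pos: "\<And>x. x \<in> S \<Longrightarrow> 0 < N x"
    and period: "\<And>x k. x \<in> S \<Longrightarrow> (f ^^ k) x = x \<longleftrightarrow> N x dvd k"
  shows "real (card {A \<in> S \<rightarrow>\<^sub>E {0, 1::nat}. \<forall>x\<in>S. A (f x) = A x}) = 2 powr (\<Sum>x\<in>S. 1 / real (N x))"
proof -
  define C where "C x = range (\<lambda>k. (f ^^ k) x)" for x
  have pow_in: "(f ^^ k) x \<in> S" if "x \<in> S" for x k
    by (induction k) (use that maps in auto)
  have C_sub: "C x \<subseteq> S" if "x \<in> S" for x
    using pow_in[OF that] by (auto simp: C_def)
  have self: "x \<in> C x" for x
    unfolding C_def by (rule image_eqI[where x = 0]) auto
  have C_f: "C ((f ^^ k) x) = C x" if x: "x \<in> S" for x k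
  proof
    show "C ((f ^^ k) x) \<subseteq> C x"
      by (auto simp: C_def) (metis comp_apply funpow_add rangeI)
    \<comment> \<open>\<open>N x * k\<close> is a multiple of the period and at least
      \<open>k\<close>, so the subtraction is exact and \<open>m\<close> further steps lead from the
      \<open>k\<close>-th iterate back to \<open>x\<close>.\<close>
    define m where "m = N x * k - k"
    have "m + k = N x * k" using pos[OF x] by (simp add: m_def)
    then have "(f ^^ (m + k)) x = x"
      by (simp only: period[OF x] dvd_triv_left)
    then have "(f ^^ m) ((f ^^ k) x) = x"
      by (simp only: funpow_add comp_apply)
    then show "C x \<subseteq> C ((f ^^ k) x)"
      by (auto simp: C_def) (metis comp_apply funpow_add rangeI)
  qed
  have C_eq: "C y = C x" if "x \<in> S" "y \<in> C x" for x y
  proof -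
    from that(2) obtain k where "y = (f ^^ k) x" by (auto simp: C_def)
    then show ?thesis using C_f[OF that(1)] by simp
  qed
  have card_C: "card (C x) = N x" if x: "x \<in> S" for x
  proof -
    have red: "(f ^^ k) x = (f ^^ (k mod N x)) x" for k
    proof -
      have "(f ^^ k) x = (f ^^ (k mod N x + N x * (k div N x))) x" by simp
      also have "\<dots> = (f ^^ (k mod N x)) ((f ^^ (N x * (k div N x))) x)"
        by (simp only: funpow_add comp_apply)
      also have "(f ^^ (N x * (k div N x))) x = x" using period[OF x] by simp
      finally show ?thesis .
    qed
    have "C x = (\<lambda>k. (f ^^ k) x) ` {..<N x}"
    proof
      show "C x \<subseteq> (\<lambda>k. (f ^^ k) x) ` {..<N x}"
      proof
        fix y assume "y \<in> C x"
        then obtain k where "y = (f ^^ k) x" by (auto simp: C_def)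
        also note red
        finally have "y = (f ^^ (k mod N x)) x" .
        then show "y \<in> (\<lambda>k. (f ^^ k) x) ` {..<N x}" using pos[OF x] by simp
      qed
    qed (auto simp: C_def)
    moreover have "inj_on (\<lambda>k. (f ^^ k) x) {..<N x}"
    proof (rule linorder_inj_onI')
      fix i j assume ij: "i \<in> {..<N x}" "j \<in> {..<N x}" "i < j"
      show "(f ^^ i) x \<noteq> (f ^^ j) x"
      proof
        assume eq: "(f ^^ i) x = (f ^^ j) x"
        \<comment> \<open>Running \<open>N x - j\<close> further steps completes the round on the
          side of \<open>j\<close>, so the side of \<open>i\<close> returns after a positive number
          of steps below \<open>N x\<close>.\<close>
        have "(f ^^ (N x - j + i)) x = (f ^^ (N x - j)) ((f ^^ j) x)"
          by (simp only: funpow_add comp_apply eq)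
        also have "\<dots> = (f ^^ (N x - j + j)) x" by (simp only: funpow_add comp_apply)
        also have "\<dots> = x" using ij period[OF x] by simp
        finally have "N x dvd N x - j + i" by (simp only: period[OF x])
        moreover have "0 < N x - j + i" "N x - j + i < N x" using ij by auto
        ultimately show False by (meson nat_dvd_not_less)
      qed
    qed
    ultimately show ?thesis by (simp only: card_image card_lessThan)
  qed
  define Q where "Q = C ` S"
  have finQ: "finite Q" using fin by (simp add: Q_def)
  have "(\<Sum>x\<in>S. 1 / real (N x)) = (\<Sum>c\<in>Q. \<Sum>x\<in>{x \<in> S. C x = c}. 1 / real (N x))"
    unfolding Q_def by (rule sum.image_gen[OF fin])
  also have "\<dots> = (\<Sum>c\<in>Q. 1)"
  proof (rule sum.cong[OF refl])
    fix c assume "c \<in> Q"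
    then obtain y where y: "y \<in> S" "c = C y" by (auto simp: Q_def)
    have eq: "{x \<in> S. C x = c} = C y"
    proof
      show "{x \<in> S. C x = c} \<subseteq> C y" using y(2) self by blast
      show "C y \<subseteq> {x \<in> S. C x = c}" using y(2) C_sub[OF y(1)] C_eq[OF y(1)] by blast
    qed
    have "N x = N y" if "x \<in> C y" for x
    proof -
      have "x \<in> S" using that C_sub[OF y(1)] by (rule subsetD[rotated])
      then show ?thesis using card_C[of x] card_C[of y] C_eq[OF y(1) that] y(1) by simp
    qed
    then show "(\<Sum>x\<in>{x \<in> S. C x = c}. 1 / real (N x)) = 1"
      using card_C[OF y(1)] pos[OF y(1)] by (simp add: eq)
  qed
  finally have sumQ: "(\<Sum>x\<in>S. 1 / real (N x)) = real (card Q)" by simp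
  have "bij_betw (\<lambda>B. \<lambda>x\<in>S. B (C x)) (Q \<rightarrow>\<^sub>E {0, 1}) {A \<in> S \<rightarrow>\<^sub>E {0, 1::nat}. \<forall>x\<in>S. A (f x) = A x}"
  \<comment> \<open>Evaluation at an arbitrary point of a cycle inverts the pullback along
    \<open>C\<close>, because an invariant function is constant on each cycle.\<close>
  proof (rule bij_betwI[where g = "\<lambda>A. \<lambda>c\<in>Q. A (SOME x. x \<in> c)"])
    have some: "(SOME z. z \<in> C x) \<in> C x" for x using self by (rule someI)
    have C1: "C (f x) = C x" if "x \<in> S" for x using C_f[OF that, of 1] by simp
    show "(\<lambda>B. \<lambda>x\<in>S. B (C x)) \<in> (Q \<rightarrow>\<^sub>E {0, 1}) \<rightarrow> {A \<in> S \<rightarrow>\<^sub>E {0, 1::nat}. \<forall>x\<in>S. A (f x) = A x}"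
      using C1 maps by (auto simp: Q_def PiE_iff)
    show "(\<lambda>A. \<lambda>c\<in>Q. A (SOME x. x \<in> c)) \<in> {A \<in> S \<rightarrow>\<^sub>E {0, 1::nat}. \<forall>x\<in>S. A (f x) = A x} \<rightarrow> (Q \<rightarrow>\<^sub>E {0, 1})"
    proof
      fix A assume A: "A \<in> {A \<in> S \<rightarrow>\<^sub>E {0, 1::nat}. \<forall>x\<in>S. A (f x) = A x}"
      have "A (SOME x. x \<in> c) \<in> {0, 1}" if "c \<in> Q" for c
      proof -
        obtain y where y: "y \<in> S" "c = C y" using \<open>c \<in> Q\<close> by (auto simp: Q_def)
        have "(SOME x. x \<in> c) \<in> S" using some[of y] C_sub[OF y(1)] unfolding y(2) by blast
        then show ?thesis using A by blast
      qed
      then show "(\<lambda>c\<in>Q. A (SOME x. x \<in> c)) \<in> Q \<rightarrow>\<^sub>E {0, 1}"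
        unfolding restrict_PiE_iff by blast
    qed
    show "(\<lambda>c\<in>Q. (\<lambda>x\<in>S. B (C x)) (SOME x. x \<in> c)) = B" if "B \<in> Q \<rightarrow>\<^sub>E {0, 1}" for B
    proof (rule extensionalityI[of _ Q])
      fix c assume "c \<in> Q"
      then obtain y where y: "y \<in> S" "c = C y" by (auto simp: Q_def)
      then show "(\<lambda>c\<in>Q. (\<lambda>x\<in>S. B (C x)) (SOME x. x \<in> c)) c = B c"
        using C_sub[OF y(1)] C_eq[OF y(1) some] some[of y] \<open>c \<in> Q\<close> by auto
    qed (use that in \<open>auto simp: PiE_iff\<close>)
    show "(\<lambda>x\<in>S. (\<lambda>c\<in>Q. A (SOME x. x \<in> c)) (C x)) = A"
      if "A \<in> {A \<in> S \<rightarrow>\<^sub>E {0, 1::nat}. \<forall>x\<in>S. A (f x) = A x}" for A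
    proof (rule extensionalityI[of _ S])
      fix x assume x: "x \<in> S"
      have "A ((f ^^ k) x) = A x" for k
        by (induction k) (use that pow_in[OF x] in auto)
      moreover obtain k where "(SOME z. z \<in> C x) = (f ^^ k) x"
        using some[of x] unfolding C_def by blast
      ultimately have "A (SOME z. z \<in> C x) = A x" by simp
      then show "(\<lambda>x\<in>S. (\<lambda>c\<in>Q. A (SOME x. x \<in> c)) (C x)) x = A x"
        using x by (simp add: Q_def)
    qed (use that in \<open>auto simp: PiE_iff\<close>)
  qed
  then have "card {A \<in> S \<rightarrow>\<^sub>E {0, 1::nat}. \<forall>x\<in>S. A (f x) = A x} = card (Q \<rightarrow>\<^sub>E {0, 1::nat})"
    by (simp add: bij_betw_same_card)
  also have "\<dots> = 2 ^ card Q"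
    by (simp add: card_PiE finQ prod_constant numeral_2_eq_2)
  finally show ?thesis by (simp add: sumQ powr_realpow)
qed

section \<open>Burnside's lemma for the affine maps of the torus\<close>

text \<open>The permutation \<open>r\<close> lifts right multiplication by \<open>t\<close> and
  carries the fibre over \<open>x\<close> onto the fibre over \<open>x \<otimes> t\<close>. Walking
  along a word in the generators links the fibre over \<open>h\<close> to that over the unit; an
  inverse letter is a step read backwards.\<close>

lemma (in group) card_fibre_eq_card_fibre_one:
  assumes T: "T \<subseteq> carrier G" and h: "h \<in> generate G T"
    and f: "\<And>p. p \<in> P \<Longrightarrow> f p \<in> carrier G"
    and r: "\<And>t. t \<in> T \<Longrightarrow> \<exists>r. bij_betw r P P \<and> (\<forall>p\<in>P. f (r p) = f p \<otimes> t)"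
  shows "card {p \<in> P. f p = h} = card {p \<in> P. f p = \<one>}"
proof -
  have in_G: "x \<in> carrier G" if "x \<in> generate G T" for x
    using generate_in_carrier[OF T that] .
  have step: "card {p \<in> P. f p = x \<otimes> t} = card {p \<in> P. f p = x}"
    if t: "t \<in> T" and x: "x \<in> carrier G" for x t
  proof -
    obtain r where r: "bij_betw r P P" "\<And>p. p \<in> P \<Longrightarrow> f (r p) = f p \<otimes> t" using r[OF t] by blast
    have tG: "t \<in> carrier G" using t T by blast
    have iff: "f (r p) = x \<otimes> t \<longleftrightarrow> f p = x" if "p \<in> P" for p
      using r(2)[OF that] right_cancel[OF tG f[OF that] x] by simp
    have "{p \<in> P. f p = x \<otimes> t} = r ` {p \<in> P. f p = x}"
    proof
      show "{p \<in> P. f p = x \<otimes> t} \<subseteq> r ` {p \<in> P. f p = x}"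
      proof
        fix q assume q: "q \<in> {p \<in> P. f p = x \<otimes> t}"
        then obtain p where p: "p \<in> P" "q = r p"
          using r(1) unfolding bij_betw_def by blast
        with q iff show "q \<in> r ` {p \<in> P. f p = x}" by blast
      qed
      show "r ` {p \<in> P. f p = x} \<subseteq> {p \<in> P. f p = x \<otimes> t}"
        using iff r(1) unfolding bij_betw_def by blast
    qed
    moreover have "inj_on r {p \<in> P. f p = x}"
      using r(1) unfolding bij_betw_def by (rule conjE) (erule inj_on_subset, blast)
    ultimately show ?thesis by (simp only: card_image)
  qed
  \<comment> \<open>Quantifying over every left factor \<open>x\<close> lets the claim compose under
    products in the induction.\<close>
  have "\<forall>x\<in>carrier G. card {p \<in> P. f p = x \<otimes> h} = card {p \<in> P. f p = x}"
    using h
  proof induction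
    case one
    show ?case by simp
  next
    case (incl t)
    then show ?case using step by blast
  next
    case (inv t)
    have tG: "t \<in> carrier G" using inv T by blast
    show ?case
    proof
      fix x assume x: "x \<in> carrier G"
      have "x \<otimes> inv t \<otimes> t = x" using x tG by (simp add: m_assoc)
      then show "card {p \<in> P. f p = x \<otimes> inv t} = card {p \<in> P. f p = x}"
        using step[OF inv, of "x \<otimes> inv t"] x tG by simp
    qed
  next
    case (eng g h)
    show ?case
    proof
      fix x assume x: "x \<in> carrier G"
      have "x \<otimes> (g \<otimes> h) = (x \<otimes> g) \<otimes> h" using x eng in_G by (simp add: m_assoc)
      then show "card {p \<in> P. f p = x \<otimes> (g \<otimes> h)} = card {p \<in> P. f p = x}"
        using eng x in_G[OF eng.hyps(1)] by simp
    qed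
  qed
  then have "card {p \<in> P. f p = \<one> \<otimes> h} = card {p \<in> P. f p = \<one>}" by (rule bspec[OF _ one_closed])
  then show ?thesis using in_G[OF h] by simp
qed

text \<open>The number of parameters and the sum over them are both \<open>k\<close> times their
  counterparts over the group, so Burnside's identity is merely multiplied by
  \<open>k\<close>.\<close>

lemma (in group_action) burnside_parametrized:
  assumes fin: "finite (carrier G)" "finite E" "finite P"
    and f: "\<And>p. p \<in> P \<Longrightarrow> f p \<in> carrier G"
    and fibre: "\<And>g. g \<in> carrier G \<Longrightarrow> card {p \<in> P. f p = g} = k"
  shows "card (orbits G E \<phi>) * card P = (\<Sum>p\<in>P. card (invariants E \<phi> (f p)))"
proof -
  have "card P = k * order G"
    using sum_card_fibre[OF fin(3,1), of f k "\<lambda>_. 1::nat"] f fibre by (auto simp: order_def)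
  moreover have "(\<Sum>p\<in>P. card (invariants E \<phi> (f p))) = k * (\<Sum>g\<in>carrier G. card (invariants E \<phi> g))"
    using sum_card_fibre[OF fin(3,1), of f k "\<lambda>g. card (invariants E \<phi> g)"] f fibre by auto
  ultimately show ?thesis
    using burnside[OF fin(1,2)] by simp
qed

section \<open>Affine maps of the torus and the group generated by the five operators\<close>

fun affine_map :: "bool \<times> int \<times> int \<times> int \<times> int \<Rightarrow> int \<times> int \<Rightarrow> int \<times> int"
  where "affine_map (t, e, d, a, b) (x, y) = (if t then (e * y + a, d * x + b) else (e * x + a, d * y + b))"

fun residue :: "nat \<Rightarrow> int \<times> int \<Rightarrow> nat \<times> nat"
  where "residue n (x, y) = (nat (x mod int n), nat (y mod int n))"

declare residue.simps [simp del]

definition torus_map :: "nat \<Rightarrow> bool \<times> int \<times> int \<times> int \<times> int \<Rightarrow> nat \<times> nat \<Rightarrow> nat \<times> nat"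
  where "torus_map n p z = residue n (affine_map p (map_prod int int z))"

definition torus_action ::
    "nat \<Rightarrow> bool \<times> int \<times> int \<times> int \<times> int \<Rightarrow> (nat \<times> nat \<Rightarrow> nat) \<Rightarrow> nat \<times> nat \<Rightarrow> nat"
  where "torus_action n p = (\<lambda>A\<in>binary_matrices n. \<lambda>z\<in>positions n. A (torus_map n p z))"

definition affine_parameters :: "nat \<Rightarrow> (bool \<times> int \<times> int \<times> int \<times> int) set"
  where "affine_parameters n = UNIV \<times> {1, -1} \<times> {1, -1} \<times> {0..<int n} \<times> {0..<int n}"

lemma residue_in_positions: "0 < n \<Longrightarrow> residue n z \<in> positions n"
  by (cases z) (auto simp: residue.simps nat_less_iff)

lemma residue_eq_iff:
  "0 < n \<Longrightarrow> residue n (x, y) = residue n (x', y') \<longleftrightarrow> [x = x'] (mod int n) \<and> [y = y'] (mod int n)"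
  by (simp add: residue.simps cong_def eq_nat_nat_iff)

lemma residue_of_nat [simp]: "z \<in> positions n \<Longrightarrow> residue n (map_prod int int z) = z"
  by (cases z) (auto simp: residue.simps)

lemma of_nat_residue:
  "0 < n \<Longrightarrow> map_prod int int (residue n (x, y)) = (x mod int n, y mod int n)"
  by (simp add: residue.simps)

text \<open>Affine maps with integer coefficients respect congruence, so iteration can take place on
  integer pairs, with a single reduction modulo \<open>n\<close> at the end.\<close>

lemma torus_map_residue:
  assumes "0 < n"
  shows "torus_map n p (residue n z) = residue n (affine_map p z)"
proof -
  obtain t e d a b x y where [simp]: "p = (t, e, d, a, b)" "z = (x, y)" by (metis prod_cases5 surj_pair)
  have "[u * (v mod int n) + w = u * v + w] (mod int n)" for u v w
    by (intro cong_add cong_mult) (auto simp: cong_def)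
  then show ?thesis
    using assms by (auto simp: torus_map_def of_nat_residue residue_eq_iff)
qed

lemma torus_map_in_positions: "0 < n \<Longrightarrow> torus_map n p z \<in> positions n"
  by (simp only: torus_map_def residue_in_positions)

lemma torus_map_funpow:
  assumes "0 < n" "z \<in> positions n"
  shows "(torus_map n p ^^ k) z = residue n ((affine_map p ^^ k) (map_prod int int z))"
  by (induction k) (use assms in \<open>simp_all add: torus_map_residue\<close>)

lemma torus_action_cong:
  assumes "0 < n" "[a = a'] (mod int n)" "[b = b'] (mod int n)"
  shows "torus_action n (t, e, d, a, b) = torus_action n (t, e, d, a', b')"
proof -
  have "torus_map n (t, e, d, a, b) = torus_map n (t, e, d, a', b')"
  proof
    fix z
    show "torus_map n (t, e, d, a, b) z = torus_map n (t, e, d, a', b') z"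
      using assms by (cases z) (auto simp: torus_map_def residue_eq_iff intro!: cong_add)
  qed
  then show ?thesis by (simp add: torus_action_def)
qed

text \<open>Substitution in the argument of a matrix reverses composition: the left factor
  \<open>p\<close> is the map applied first to a position. Membership in \<open>Bij\<close> is
  required because multiplication in \<open>BijGroup\<close> is composition only there.\<close>

lemma torus_action_mult:
  assumes n: "0 < n"
    and Bij: "torus_action n p \<in> Bij (binary_matrices n)" "torus_action n q \<in> Bij (binary_matrices n)"
    and comp: "\<And>z. affine_map q (affine_map p z) = affine_map r z"
  shows "torus_action n p \<otimes>\<^bsub>BijGroup (binary_matrices n)\<^esub> torus_action n q = torus_action n r"
proof -
  have "torus_map n q (torus_map n p z) = torus_map n r z" for z
    using comp torus_map_residue[OF n] by (simp add: torus_map_def)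
  moreover have "(\<lambda>z\<in>positions n. A (torus_map n q z)) \<in> binary_matrices n" if "A \<in> binary_matrices n" for A
    using that torus_map_in_positions[OF n]
    unfolding binary_matrices_def restrict_PiE_iff by (metis PiE_mem)
  ultimately show ?thesis
    using Bij torus_map_in_positions[OF n, of p]
    by (auto simp: BijGroup_def torus_action_def compose_def fun_eq_iff restrict_def)
qed

lemma mod_minus_one_nat: "0 < n \<Longrightarrow> nat ((int i - 1) mod int n) = (i + (n - 1)) mod n"
proof -
  assume "0 < n"
  then have "(int i - 1) mod int n = int ((i + (n - 1)) mod n)"
    by (simp add: zmod_int of_nat_diff) (metis add.commute add_diff_eq diff_add_eq mod_add_self1)
  then show ?thesis by simp
qed

text \<open>Counting indices from the other end is \<open>x \<mapsto> - x - 1\<close> modulo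
  \<open>n\<close>, the source of the offset -1 in the parameters of the reflections.\<close>

lemma reflect_nat: "i < n \<Longrightarrow> nat ((- int i - 1) mod int n) = n - 1 - i"
proof -
  assume "i < n"
  then have "(- int i - 1) mod int n = (int (n - 1 - i)) mod int n"
    by (simp add: of_nat_diff mod_eq_dvd_iff)
  also have "\<dots> = int (n - 1 - i)"
    by (rule mod_pos_pos_trivial) (use \<open>i < n\<close> in auto)
  finally show ?thesis by simp
qed

lemma row_rotation_eq: "0 < n \<Longrightarrow> row_rotation n = torus_action n (False, 1, 1, -1, 0)"
  unfolding row_rotation_def torus_action_def
  by (intro restrict_ext) (auto simp: torus_map_def residue.simps mod_minus_one_nat)

lemma column_rotation_eq: "0 < n \<Longrightarrow> column_rotation n = torus_action n (False, 1, 1, 0, -1)"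
  unfolding column_rotation_def torus_action_def
  by (intro restrict_ext) (auto simp: torus_map_def residue.simps mod_minus_one_nat)

lemma row_reflection_eq: "row_reflection n = torus_action n (False, -1, 1, -1, 0)"
  unfolding row_reflection_def torus_action_def
  by (intro restrict_ext) (auto simp: torus_map_def residue.simps reflect_nat)

lemma column_reflection_eq: "column_reflection n = torus_action n (False, 1, -1, 0, -1)"
  unfolding column_reflection_def torus_action_def
  by (intro restrict_ext) (auto simp: torus_map_def residue.simps reflect_nat)

lemma transposition_eq: "transposition n = torus_action n (True, 1, 1, 0, 0)"
  unfolding transposition_def torus_action_def
  by (intro restrict_ext) (auto simp: torus_map_def residue.simps)

lemma torus_action_generators:
  assumes "0 < n"
  shows "toroidal_generators n = torus_action n `
    {(False, 1, 1, -1, 0), (False, 1, 1, 0, -1), (False, -1, 1, -1, 0), (False, 1, -1, 0, -1), (True, 1, 1, 0, 0)}"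
  using assms by (simp add: toroidal_generators_def row_rotation_eq column_rotation_eq row_reflection_eq
      column_reflection_eq transposition_eq)

text \<open>The new parameters belong to the old map followed by a generator. A reflection negates
  the offset along with the sign, and transposition exchanges the data of the two
  coordinates.\<close>

lemma torus_action_step:
  fixes n t e d a b
  defines "H \<equiv> generate (BijGroup (binary_matrices n)) (toroidal_generators n)"
  assumes n: "0 < n" and p: "torus_action n (t, e, d, a, b) \<in> H"
  shows "torus_action n (t, e, d, a - 1, b) \<in> H" "torus_action n (t, e, d, a, b - 1) \<in> H"
    "torus_action n (t, - e, d, - a - 1, b) \<in> H" "torus_action n (t, e, - d, a, - b - 1) \<in> H"
    "torus_action n (\<not> t, d, e, b, a) \<in> H"
proof -
  interpret B: group "BijGroup (binary_matrices n)" by (rule group_BijGroup)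
  have Bij: "x \<in> Bij (binary_matrices n)" if "x \<in> H" for x
    using B.generate_in_carrier[OF toroidal_generators_subset that[unfolded H_def]]
    by (simp add: BijGroup_def)
  have step: "torus_action n r \<in> H"
    if "torus_action n q \<in> toroidal_generators n"
      and "\<And>z. affine_map q (affine_map (t, e, d, a, b) z) = affine_map r z" for q r
  proof -
    have q: "torus_action n q \<in> H" using that(1) unfolding H_def by (rule generate.incl)
    have "torus_action n (t, e, d, a, b) \<otimes>\<^bsub>BijGroup (binary_matrices n)\<^esub> torus_action n q \<in> H"
      using p q unfolding H_def by (rule generate.eng)
    then show ?thesis
      using torus_action_mult[OF n Bij[OF p] Bij[OF q] that(2)] by simp
  qed
  note gens = torus_action_generators[OF n]
  show "torus_action n (t, e, d, a - 1, b) \<in> H"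
    by (rule step[of "(False, 1, 1, -1, 0)"]) (auto simp: gens)
  show "torus_action n (t, e, d, a, b - 1) \<in> H"
    by (rule step[of "(False, 1, 1, 0, -1)"]) (auto simp: gens)
  show "torus_action n (t, - e, d, - a - 1, b) \<in> H"
    by (rule step[of "(False, -1, 1, -1, 0)"]) (auto simp: gens)
  show "torus_action n (t, e, - d, a, - b - 1) \<in> H"
    by (rule step[of "(False, 1, -1, 0, -1)"]) (auto simp: gens)
  show "torus_action n (\<not> t, d, e, b, a) \<in> H"
    by (rule step[of "(True, 1, 1, 0, 0)"]) (auto simp: gens)
qed

text \<open>Rotations move the offsets to any residues, so an offset disturbed by flipping a sign
  can be restored; transposition then supplies the other half of the parameters.\<close>

lemma torus_action_in_generate:
  assumes n: "0 < n" and p: "p \<in> affine_parameters n"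
  shows "torus_action n p \<in> generate (BijGroup (binary_matrices n)) (toroidal_generators n)"
    (is "_ \<in> ?H")
proof -
  note step = torus_action_step[OF n]
  have shift: "torus_action n (t, e, d, a', b') \<in> ?H"
    if "torus_action n (t, e, d, a, b) \<in> ?H" for t e d a b a' b'
  proof -
    have a: "torus_action n (t, e, d, a - int k, b) \<in> ?H" for k
    proof (induction k)
      case (Suc k)
      show ?case using step(1)[OF Suc] by (simp add: algebra_simps)
    qed (use that in simp)
    have 1: "torus_action n (t, e, d, a - int k, b - int l) \<in> ?H" for k l
    proof (induction l)
      case (Suc l)
      show ?case using step(2)[OF Suc] by (simp add: algebra_simps)
    qed (use a in simp)
    \<comment> \<open>Rotations only lower an offset, so \<open>a'\<close> is reached from
      \<open>a\<close>, up to a multiple of \<open>n\<close>, by \<open>(a - a') mod int n\<close>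
      steps down.\<close>
    have cong: "[u - int (nat ((u - v) mod int n)) = v] (mod int n)" for u v
      using n by (simp add: cong_def mod_diff_right_eq)
    show ?thesis
      using 1[of "nat ((a - a') mod int n)" "nat ((b - b') mod int n)"]
        torus_action_cong[OF n cong[of a a'] cong[of b b']] by simp
  qed
  have "torus_action n (False, 1, 1, 0, 0) = (\<lambda>A\<in>binary_matrices n. A)"
    unfolding torus_action_def
    by (intro restrict_ext extensionalityI[of _ "positions n"])
      (auto simp: torus_map_def residue.simps binary_matrices_def PiE_iff)
  then have one: "torus_action n (False, 1, 1, 0, 0) \<in> ?H"
    using generate.one[of "BijGroup (binary_matrices n)"] by (simp add: BijGroup_def)
  have row: "torus_action n (False, e, 1, 0, 0) \<in> ?H" if "e \<in> {1, -1}" for e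
    using that one shift[OF step(3)[OF one]] by auto
  have corner: "torus_action n (False, e, d, 0, 0) \<in> ?H" if "e \<in> {1, -1}" "d \<in> {1, -1}" for e d
    using that row shift[OF step(4)[OF row]] by auto
  have all: "torus_action n (False, e, d, a, b) \<in> ?H" if "e \<in> {1, -1}" "d \<in> {1, -1}" for e d a b
    by (rule shift[OF corner[OF that]])
  then have all': "torus_action n (True, e, d, a, b) \<in> ?H" if "e \<in> {1, -1}" "d \<in> {1, -1}" for e d a b
    using that step(5)[of False d e b a] by simp
  obtain t e d a b where "p = (t, e, d, a, b)" by (metis prod_cases5)
  then show ?thesis
    using p all[of e d a b] all'[of e d a b] by (cases t) (simp_all add: affine_parameters_def)
qed

text \<open>This provides the bijection \<open>r\<close> for
  \<open>card_fibre_eq_card_fibre_one\<close>. Offsets must stay among the representatives below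
  \<open>n\<close>, so rotations reduce modulo \<open>n\<close>, and reflections use
  \<open>n - 1 - a\<close> in place of \<open>- a - 1\<close>, which makes them involutions.\<close>

lemma torus_action_permutes_parameters:
  assumes n: "0 < n" and g: "g \<in> toroidal_generators n"
  shows "\<exists>r. bij_betw r (affine_parameters n) (affine_parameters n) \<and>
    (\<forall>p\<in>affine_parameters n. torus_action n (r p) = torus_action n p \<otimes>\<^bsub>BijGroup (binary_matrices n)\<^esub> g)"
proof -
  interpret B: group "BijGroup (binary_matrices n)" by (rule group_BijGroup)
  let ?P = "affine_parameters n"
  have Bij: "torus_action n p \<in> Bij (binary_matrices n)" if "p \<in> ?P" for p
    using B.generate_in_carrier[OF toroidal_generators_subset torus_action_in_generate[OF n that]]
    by (simp add: BijGroup_def)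
  have Bij_gen: "torus_action n q \<in> Bij (binary_matrices n)" if "torus_action n q \<in> toroidal_generators n" for q
    using toroidal_generators_subset that by (auto simp: BijGroup_def)
  have mult: "torus_action n p \<otimes>\<^bsub>BijGroup (binary_matrices n)\<^esub> torus_action n q = torus_action n r"
    if "p \<in> ?P" "torus_action n q \<in> toroidal_generators n"
      "\<And>z. affine_map q (affine_map p z) = affine_map r z" for p q r
    using torus_action_mult[OF n Bij[OF that(1)] Bij_gen[OF that(2)] that(3)] .
  note gens = torus_action_generators[OF n]
  consider "g = torus_action n (False, 1, 1, -1, 0)" | "g = torus_action n (False, 1, 1, 0, -1)"
    | "g = torus_action n (False, -1, 1, -1, 0)" | "g = torus_action n (False, 1, -1, 0, -1)"
    | "g = torus_action n (True, 1, 1, 0, 0)"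
    using g unfolding gens by blast
  then show ?thesis
  proof cases
    case 1
    let ?r = "\<lambda>(t, e, d, a, b). (t, e, d, (a - 1) mod int n, b)"
    have "bij_betw ?r ?P ?P"
      by (rule bij_betwI[where g = "\<lambda>(t, e, d, a, b). (t, e, d, (a + 1) mod int n, b)"])
        (use n in \<open>auto simp: affine_parameters_def mod_simps\<close>)
    moreover have "torus_action n (?r p) = torus_action n p \<otimes>\<^bsub>BijGroup (binary_matrices n)\<^esub> g" if "p \<in> ?P" for p
    proof -
      obtain t e d a b where p: "p = (t, e, d, a, b)" by (metis prod_cases5)
      show ?thesis
        unfolding 1 using mult[of p "(False, 1, 1, -1, 0)" "(t, e, d, a - 1, b)"] that
          torus_action_cong[OF n, of "(a - 1) mod int n" "a - 1" b b t e d]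
        by (auto simp: p gens)
    qed
    ultimately show ?thesis by blast
  next
    case 2
    let ?r = "\<lambda>(t, e, d, a, b). (t, e, d, a, (b - 1) mod int n)"
    have "bij_betw ?r ?P ?P"
      by (rule bij_betwI[where g = "\<lambda>(t, e, d, a, b). (t, e, d, a, (b + 1) mod int n)"])
        (use n in \<open>auto simp: affine_parameters_def mod_simps\<close>)
    moreover have "torus_action n (?r p) = torus_action n p \<otimes>\<^bsub>BijGroup (binary_matrices n)\<^esub> g" if "p \<in> ?P" for p
    proof -
      obtain t e d a b where p: "p = (t, e, d, a, b)" by (metis prod_cases5)
      show ?thesis
        unfolding 2 using mult[of p "(False, 1, 1, 0, -1)" "(t, e, d, a, b - 1)"] that
          torus_action_cong[OF n, of a a "(b - 1) mod int n" "b - 1" t e d]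
        by (auto simp: p gens)
    qed
    ultimately show ?thesis by blast
  next
    case 3
    let ?r = "\<lambda>(t, e, d, a, b). (t, - e, d, int n - 1 - a, b)"
    have "bij_betw ?r ?P ?P"
      by (rule bij_betwI[where g = ?r]) (auto simp: affine_parameters_def)
    moreover have "torus_action n (?r p) = torus_action n p \<otimes>\<^bsub>BijGroup (binary_matrices n)\<^esub> g" if "p \<in> ?P" for p
    proof -
      obtain t e d a b where p: "p = (t, e, d, a, b)" by (metis prod_cases5)
      show ?thesis
        unfolding 3 using mult[of p "(False, -1, 1, -1, 0)" "(t, - e, d, - a - 1, b)"] that
          torus_action_cong[OF n, of "int n - 1 - a" "- a - 1" b b t "- e" d]
        by (auto simp: p gens cong_iff_dvd_diff)
    qed
    ultimately show ?thesis by blast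
  next
    case 4
    let ?r = "\<lambda>(t, e, d, a, b). (t, e, - d, a, int n - 1 - b)"
    have "bij_betw ?r ?P ?P"
      by (rule bij_betwI[where g = ?r]) (auto simp: affine_parameters_def)
    moreover have "torus_action n (?r p) = torus_action n p \<otimes>\<^bsub>BijGroup (binary_matrices n)\<^esub> g" if "p \<in> ?P" for p
    proof -
      obtain t e d a b where p: "p = (t, e, d, a, b)" by (metis prod_cases5)
      show ?thesis
        unfolding 4 using mult[of p "(False, 1, -1, 0, -1)" "(t, e, - d, a, - b - 1)"] that
          torus_action_cong[OF n, of a a "int n - 1 - b" "- b - 1" t e "- d"]
        by (auto simp: p gens cong_iff_dvd_diff)
    qed
    ultimately show ?thesis by blast
  next
    case 5
    let ?r = "\<lambda>(t, e, d, a, b). (\<not> t, d, e, b, a)"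
    have "bij_betw ?r ?P ?P"
      by (rule bij_betwI[where g = ?r]) (auto simp: affine_parameters_def)
    moreover have "torus_action n (?r p) = torus_action n p \<otimes>\<^bsub>BijGroup (binary_matrices n)\<^esub> g" if "p \<in> ?P" for p
    proof -
      obtain t e d a b where p: "p = (t, e, d, a, b)" by (metis prod_cases5)
      show ?thesis
        unfolding 5 using mult[of p "(True, 1, 1, 0, 0)" "(\<not> t, d, e, b, a)"] that
        by (auto simp: p gens)
    qed
    ultimately show ?thesis by blast
  qed
qed

lemma card_affine_parameters: "card (affine_parameters n) = 8 * n\<^sup>2"
  by (simp add: affine_parameters_def card_cartesian_product power2_eq_square)

definition fixed_matrices :: "nat \<Rightarrow> bool \<times> int \<times> int \<times> int \<times> int \<Rightarrow> (nat \<times> nat \<Rightarrow> nat) set"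
  where "fixed_matrices n p = {A \<in> positions n \<rightarrow>\<^sub>E {0, 1}. \<forall>z\<in>positions n. A (torus_map n p z) = A z}"

theorem toroidal_beta_burnside:
  assumes n: "0 < n"
  shows "toroidal_beta n * (8 * n\<^sup>2) = (\<Sum>p\<in>affine_parameters n. card (fixed_matrices n p))"
proof -
  interpret B: group "BijGroup (binary_matrices n)" by (rule group_BijGroup)
  interpret T: group_action "toroidal_group n" "binary_matrices n" "\<lambda>g. g" by (rule toroidal_group_action)
  let ?H = "generate (BijGroup (binary_matrices n)) (toroidal_generators n)"
  have carrier: "carrier (toroidal_group n) = ?H" by (simp add: toroidal_group_def)
  have fin: "finite (binary_matrices n)"
    by (simp add: binary_matrices_def finite_PiE)
  have "?H \<subseteq> Bij (binary_matrices n)"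
    using B.generate_incl[OF toroidal_generators_subset] by (simp add: BijGroup_def)
  also have "\<dots> \<subseteq> binary_matrices n \<rightarrow>\<^sub>E binary_matrices n"
    by (auto simp: Bij_def PiE_def bij_betw_def)
  finally have finH: "finite ?H"
    using fin finite_PiE finite_subset by (metis (no_types, lifting))
  have Bij: "torus_action n p \<in> ?H" if "p \<in> affine_parameters n" for p
    by (rule torus_action_in_generate[OF n that])
  have "card (orbits (toroidal_group n) (binary_matrices n) (\<lambda>g. g)) * card (affine_parameters n) =
    (\<Sum>p\<in>affine_parameters n. card (invariants (binary_matrices n) (\<lambda>g. g) (torus_action n p)))"
  proof (rule T.burnside_parametrized)
    show "finite (affine_parameters n)" by (simp add: affine_parameters_def)
    \<comment> \<open>The common fibre size is the size of the fibre over the unit, left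
      unevaluated.\<close>
    show "card {p \<in> affine_parameters n. torus_action n p = g} =
        card {p \<in> affine_parameters n. torus_action n p = \<one>\<^bsub>BijGroup (binary_matrices n)\<^esub>}"
      if "g \<in> carrier (toroidal_group n)" for g
      by (rule B.card_fibre_eq_card_fibre_one[OF toroidal_generators_subset])
        (use that B.generate_in_carrier[OF toroidal_generators_subset Bij]
          torus_action_permutes_parameters[OF n] in \<open>auto simp: carrier\<close>)
  qed (use finH fin Bij carrier in auto)
  moreover have "invariants (binary_matrices n) (\<lambda>g. g) (torus_action n p) = fixed_matrices n p" for p
  proof -
    have "torus_action n p A = A \<longleftrightarrow> (\<forall>z\<in>positions n. A (torus_map n p z) = A z)"
      if A: "A \<in> positions n \<rightarrow>\<^sub>E {0, 1}" for A
    proof -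
      have "torus_action n p A = (\<lambda>z\<in>positions n. A (torus_map n p z))"
        using A by (simp add: torus_action_def binary_matrices_def)
      then show ?thesis
        using PiE_restrict[OF A] by (metis (no_types, lifting) restrict_apply' restrict_ext)
    qed
    then show ?thesis by (auto simp: invariants_def binary_matrices_def fixed_matrices_def)
  qed
  ultimately show ?thesis
    by (simp add: toroidal_beta_def card_affine_parameters)
qed

section \<open>Additive orders and halving modulo n\<close>

definition add_order :: "nat \<Rightarrow> int \<Rightarrow> nat"
  where "add_order n a = nat (int n div gcd (int n) a)"

lemma add_order_pos: "0 < n \<Longrightarrow> 0 < add_order n a"
  by (simp add: add_order_def pos_imp_zdiv_pos_iff zdvd_imp_le)

text \<open>Dividing \<open>n\<close> and \<open>a\<close> by their gcd leaves coprime
  \<open>u\<close> and \<open>v\<close>, and \<open>u\<close> divides \<open>j * v\<close> iff it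
  divides \<open>j\<close>. An integer \<open>j\<close> is allowed because glide reflections lead to
  differences of exponents.\<close>

lemma add_order_dvd_iff:
  assumes "0 < n"
  shows "int (add_order n a) dvd j \<longleftrightarrow> int n dvd j * a"
proof -
  define g where "g = gcd (int n) a"
  have g: "g > 0" using assms by (simp add: g_def)
  obtain u v where uv: "int n = u * g" "a = v * g" and cop: "coprime u v"
    using gcd_coprime_exists[of "int n" a] g unfolding g_def by force
  have "u > 0" using uv(1) g assms by (metis of_nat_0_less_iff zero_less_mult_pos2)
  moreover have "add_order n a = nat (int n div g)" by (simp only: add_order_def g_def)
  moreover have "int n div g = u" using uv(1) g by simp
  ultimately have "int (add_order n a) = u" by simp
  moreover have "int n dvd j * a \<longleftrightarrow> u * g dvd (j * v) * g"
    by (simp add: uv ac_simps)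
  ultimately show ?thesis
    using g cop by (simp add: coprime_dvd_mult_left_iff)
qed

lemma add_order_dvd_nat_iff: "0 < n \<Longrightarrow> add_order n a dvd k \<longleftrightarrow> int n dvd int k * a"
  using add_order_dvd_iff[of n a "int k"] by simp

text \<open>The residues of order \<open>d\<close> are those whose gcd with \<open>n\<close> is
  \<open>n div d\<close>, and there are \<open>totient d\<close> of them.\<close>

lemma sum_add_order:
  fixes g :: "nat \<Rightarrow> real"
  assumes n: "0 < n"
  shows "(\<Sum>a\<in>{0..<int n}. g (add_order n a)) = (\<Sum>d | d dvd n. real (totient d) * g d)"
proof -
  define f where "f k = g (n div gcd k n)" for k
  have f_nat: "f (nat a) = g (add_order n a)" if "a \<in> {0..<int n}" for a
  proof -
    have "add_order n (int (nat a)) = n div gcd (nat a) n"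
      by (simp add: add_order_def gcd.commute[of n] del: int_nat_eq flip: zdiv_int)
    then show ?thesis using that by (simp add: f_def)
  qed
  have "(\<Sum>a\<in>{0..<int n}. g (add_order n a)) = (\<Sum>k<n. f k)"
    by (rule sum.reindex_bij_witness[of _ int nat]) (auto simp: f_nat)
  \<comment> \<open>The totient count runs over 1 to \<open>n\<close>, so the residue 0 is traded
    for \<open>n\<close>; both have order 1.\<close>
  also have "\<dots> = (\<Sum>k<n. f (Suc k))"
    using sum.lessThan_Suc_shift[of f n] by (simp add: f_def)
  also have "\<dots> = (\<Sum>k\<in>{0<..n}. f k)"
    by (rule sum.reindex_bij_witness[of _ "\<lambda>k. k - 1" Suc]) auto
  also have "\<dots> = (\<Sum>d | d dvd n. \<Sum>k\<in>{k \<in> {0<..n}. n div gcd k n = d}. f k)"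
    by (rule sum.group[symmetric]) (use n in \<open>auto simp: div_dvd_iff_mult\<close>)
  also have "\<dots> = (\<Sum>d | d dvd n. real (totient d) * g d)"
  proof (rule sum.cong[OF refl])
    fix d assume "d \<in> {d. d dvd n}"
    then obtain m where m: "n = d * m" by auto
    have "0 < m" "0 < d" using m n by auto
    have "n div gcd k n = d \<longleftrightarrow> gcd k n = m" for k
    proof
      assume "n div gcd k n = d"
      then have "n = d * gcd k n" by (metis dvd_div_mult_self gcd_dvd2)
      then show "gcd k n = m" using m \<open>0 < d\<close> by simp
    qed (use m \<open>0 < m\<close> in simp)
    then have "card {k \<in> {0<..n}. n div gcd k n = d} = totient d"
      using card_gcd_eq_totient[of n m] m n \<open>0 < m\<close> by simp
    then show "(\<Sum>k\<in>{k \<in> {0<..n}. n div gcd k n = d}. f k) = real (totient d) * g d"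
      by (simp add: f_def)
  qed
  finally show ?thesis .
qed

lemma sum_periodic_shift:
  fixes f :: "int \<Rightarrow> real"
  assumes n: "0 < n" and f: "\<And>a b. [a = b] (mod int n) \<Longrightarrow> f a = f b"
  shows "(\<Sum>a\<in>{0..<int n}. f (a + c)) = (\<Sum>a\<in>{0..<int n}. f a)"
  by (rule sum.reindex_bij_witness[of _ "\<lambda>a. (a - c) mod int n" "\<lambda>a. (a + c) mod int n"])
    (use n in \<open>auto simp: mod_simps cong_def intro!: f\<close>)

lemma add_order_cong: "[a = b] (mod int n) \<Longrightarrow> add_order n a = add_order n b"
  by (simp add: add_order_def gcd.commute[of "int n"] cong_gcd_eq)

text \<open>These are the fixed points of the reflection \<open>x \<mapsto> c - x\<close> modulo
  \<open>n\<close>.\<close>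

definition halves :: "nat \<Rightarrow> int \<Rightarrow> nat set"
  where "halves n c = {x \<in> {..<n}. [2 * int x = c] (mod int n)}"

lemma card_residue_class:
  assumes "0 < n"
  shows "card {x \<in> {..<n}. [int x = c] (mod int n)} = 1"
proof -
  have "{x \<in> {..<n}. [int x = c] (mod int n)} = {nat (c mod int n)}"
    using assms by (auto simp: cong_def nat_less_iff)
  then show ?thesis by simp
qed

lemma card_halves_odd:
  assumes "odd n"
  shows "card (halves n c) = 1"
proof -
  obtain m where m: "n = 2 * m + 1" using assms by (auto elim: oddE)
  \<comment> \<open>\<open>m + 1\<close> is the inverse of 2 modulo \<open>n\<close>, since
    \<open>2 * (m + 1) = n + 1\<close>.\<close>
  have "[2 * int x = c] (mod int n) \<longleftrightarrow> [int x = (int m + 1) * c] (mod int n)" for x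
  proof
    assume "[2 * int x = c] (mod int n)"
    then have "[(int m + 1) * (2 * int x) = (int m + 1) * c] (mod int n)" by (rule cong_scalar_left)
    moreover have "(int m + 1) * (2 * int x) = int x + int n * int x" by (simp add: m algebra_simps)
    ultimately show "[int x = (int m + 1) * c] (mod int n)" by (simp add: cong_def)
  next
    assume "[int x = (int m + 1) * c] (mod int n)"
    then have "[2 * int x = 2 * ((int m + 1) * c)] (mod int n)" by (rule cong_scalar_left)
    moreover have "2 * ((int m + 1) * c) = c + int n * c" by (simp add: m algebra_simps)
    ultimately show "[2 * int x = c] (mod int n)" by (simp add: cong_def)
  qed
  then show ?thesis using card_residue_class[of n] m by (simp add: halves_def)
qed

text \<open>With \<open>n = 2 * m\<close> and \<open>c = 2 * e\<close> the condition becomes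
  \<open>x = e\<close> modulo \<open>m\<close>, which leaves \<open>r\<close> and
  \<open>r + m\<close> below \<open>n\<close>; an odd \<open>c\<close> fails by parity.\<close>

lemma card_halves_even:
  assumes "even n" "0 < n"
  shows "card (halves n c) = (if even c then 2 else 0)"
proof (cases "even c")
  case True
  then obtain e where e: "c = 2 * e" by (auto elim: evenE)
  obtain m where m: "n = 2 * m" using assms by (auto elim: evenE)
  have m0: "0 < m" using m assms by simp
  define r where "r = nat (e mod int m)"
  have r: "r < m" "int r = e mod int m" using m0 by (auto simp: r_def nat_less_iff)
  have "[2 * int x = c] (mod int n) \<longleftrightarrow> x mod m = r" for x
  proof -
    have "[2 * int x = c] (mod int n) \<longleftrightarrow> int x mod int m = e mod int m"
      by (simp add: e m cong_def flip: mult_mod_right)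
    also have "\<dots> \<longleftrightarrow> x mod m = r" by (simp flip: r(2) zmod_int)
    finally show ?thesis .
  qed
  moreover have "x < n \<and> x mod m = r \<longleftrightarrow> x = r \<or> x = r + m" for x
  proof (cases "x < m")
    case False
    then obtain y where "x = m + y" by (metis le_Suc_ex not_less)
    then show ?thesis using r(1) by (cases "y < m") (auto simp: m)
  qed (use r(1) in \<open>auto simp: m\<close>)
  ultimately have "halves n c = {r, r + m}"
    by (auto simp: halves_def)
  then show ?thesis using True m0 by simp
next
  case False
  have "halves n c = {}"
    using False assms by (auto simp: halves_def) (metis cong_dvd_iff cong_dvd_modulus dvd_triv_left even_of_nat cong_sym)
  then show ?thesis using False by simp
qed

lemma card_halves_cong:
  assumes "[a = b] (mod int n)"
  shows "card (halves n a) = card (halves n b)"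
  using assms by (simp add: halves_def cong_def)

lemma sum_card_halves:
  fixes g :: "nat \<Rightarrow> real"
  assumes n: "0 < n"
  shows "(\<Sum>a\<in>{0..<int n}. g (card (halves n a))) =
    (if odd n then real n * g 1 else real n / 2 * (g 0 + g 2))"
proof (cases "odd n")
  case False
  then obtain m where m: "n = 2 * m" by blast
  have "(\<Sum>a\<in>{0..<int n}. g (card (halves n a))) = (\<Sum>k<2 * m. if even k then g 2 else g 0)"
    by (rule sum.reindex_bij_witness[of _ int nat]) (use False n card_halves_even in \<open>auto simp: m even_nat_iff\<close>)
  also have "\<dots> = real m * (g 0 + g 2)"
    by (induction m) (auto simp: algebra_simps)
  finally show ?thesis using False m by simp
qed (simp add: card_halves_odd)

section \<open>Periods of positions and the passage from periods to fixed matrices\<close>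

lemma affine_map_plain_funpow:
  "(affine_map (False, e, d, a, b) ^^ k) (x, y) = (((\<lambda>x. e * x + a) ^^ k) x, ((\<lambda>y. d * y + b) ^^ k) y)"
  by (induction k) auto

text \<open>A translation has the same period at every point. A reflection is an involution, so its
  periods are 1 and 2; every \<open>e\<close> other than 1 stands for -1 here.\<close>

definition coordinate_period :: "nat \<Rightarrow> int \<Rightarrow> int \<Rightarrow> nat \<Rightarrow> nat"
  where "coordinate_period n e a x =
    (if e = 1 then add_order n a else if x \<in> halves n a then 1 else 2)"

lemma coordinate_period_pos: "0 < n \<Longrightarrow> 0 < coordinate_period n e a x"
  by (simp add: coordinate_period_def add_order_pos)

lemma coordinate_period_dvd_iff:
  assumes n: "0 < n" and e: "e \<in> {1, -1}" and x: "x < n"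
  shows "[((\<lambda>x. e * x + a) ^^ k) (int x) = int x] (mod int n) \<longleftrightarrow> coordinate_period n e a x dvd k"
proof (cases "e = 1")
  case True
  have "((\<lambda>x. e * x + a) ^^ k) z = z + int k * a" for z
    by (induction k) (auto simp: True algebra_simps)
  then show ?thesis
    using True by (simp add: coordinate_period_def add_order_dvd_nat_iff[OF n] cong_iff_dvd_diff)
next
  case False
  then have e: "e = -1" using e by simp
  have "((\<lambda>x. e * x + a) ^^ k) z = (if even k then z else a - z)" for z
    by (induction k) (auto simp: e)
  moreover have "[a - int x = int x] (mod int n) \<longleftrightarrow> [2 * int x = a] (mod int n)"
    by (auto simp: cong_iff_dvd_diff dvd_diff_commute[of _ a] algebra_simps)
  ultimately show ?thesis
    using e x by (simp add: coordinate_period_def halves_def)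
qed

text \<open>Counting is reduced to a divisibility test on iterates over the integers: an
  \<open>N\<close> that passes it is the period on the torus, since reduction modulo
  \<open>n\<close> commutes with iteration.\<close>

lemma card_fixed_matrices:
  assumes n: "0 < n"
    and pos: "\<And>x y. x < n \<Longrightarrow> y < n \<Longrightarrow> 0 < N x y"
    and period: "\<And>x y k u v. x < n \<Longrightarrow> y < n \<Longrightarrow> (affine_map p ^^ k) (int x, int y) = (u, v) \<Longrightarrow>
      [u = int x] (mod int n) \<and> [v = int y] (mod int n) \<longleftrightarrow> N x y dvd k"
  shows "real (card (fixed_matrices n p)) = 2 powr (\<Sum>x<n. \<Sum>y<n. 1 / real (N x y))"
proof -
  have "real (card (fixed_matrices n p)) = 2 powr (\<Sum>z\<in>positions n. 1 / real (case z of (x, y) \<Rightarrow> N x y))"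
    unfolding fixed_matrices_def
  proof (rule card_cycle_invariant_functions)
    fix z k assume z: "z \<in> positions n"
    obtain x y where xy: "z = (x, y)" "x < n" "y < n" using z by auto
    obtain u v where uv: "(affine_map p ^^ k) (int x, int y) = (u, v)" by (metis surj_pair)
    have z_eq: "z = residue n (int x, int y)" using residue_of_nat[OF z] xy by simp
    have "(torus_map n p ^^ k) z = residue n (u, v)"
      using torus_map_funpow[OF n z, where p = p and k = k] uv xy(1) by simp
    then have "(torus_map n p ^^ k) z = z \<longleftrightarrow> residue n (u, v) = residue n (int x, int y)"
      using z_eq by metis
    also have "\<dots> \<longleftrightarrow> N x y dvd k"
      unfolding residue_eq_iff[OF n] using period[OF xy(2,3) uv] .
    finally show "(torus_map n p ^^ k) z = z \<longleftrightarrow> (case z of (x, y) \<Rightarrow> N x y) dvd k"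
      by (simp add: xy)
  qed (use n pos torus_map_in_positions in auto)
  also have "(\<Sum>z\<in>positions n. 1 / real (case z of (x, y) \<Rightarrow> N x y)) = (\<Sum>x<n. \<Sum>y<n. 1 / real (N x y))"
    by (simp add: sum.cartesian_product case_prod_unfold)
  finally show ?thesis .
qed

text \<open>The coordinates move independently, so a position returns exactly when both coordinate
  periods divide the exponent.\<close>

lemma card_fixed_matrices_plain:
  assumes n: "0 < n" and ed: "e \<in> {1, -1}" "d \<in> {1, -1}"
  shows "real (card (fixed_matrices n (False, e, d, a, b))) =
    2 powr (\<Sum>x<n. \<Sum>y<n. 1 / real (lcm (coordinate_period n e a x) (coordinate_period n d b y)))"
proof (rule card_fixed_matrices[OF n])
  fix x y k u v
  assume xy: "x < n" "y < n" and uv: "(affine_map (False, e, d, a, b) ^^ k) (int x, int y) = (u, v)"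
  show "[u = int x] (mod int n) \<and> [v = int y] (mod int n) \<longleftrightarrow>
      lcm (coordinate_period n e a x) (coordinate_period n d b y) dvd k"
    using uv coordinate_period_dvd_iff[OF n ed(1) xy(1)] coordinate_period_dvd_iff[OF n ed(2) xy(2)]
    by (auto simp: affine_map_plain_funpow)
qed (use coordinate_period_pos[OF n] in \<open>simp add: lcm_pos_nat\<close>)

section \<open>Fixed matrices of a single map\<close>

lemma sum_if_halves:
  fixes u v :: real
  shows "(\<Sum>x<n. if x \<in> halves n a then u else v) =
    real (card (halves n a)) * u + (real n - real (card (halves n a))) * v"
proof -
  have sub: "halves n a \<subseteq> {..<n}" by (auto simp: halves_def)
  have "(\<Sum>x<n. if x \<in> halves n a then u else v) = (\<Sum>x<n. v + (if x \<in> halves n a then u - v else 0))"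
    by (rule sum.cong) auto
  also have "\<dots> = real n * v + real (card (halves n a)) * (u - v)"
    using sub by (simp add: sum.distrib sum.If_cases Int_absorb1)
  finally show ?thesis by (simp add: algebra_simps)
qed

lemma card_fixed_translation:
  assumes n: "0 < n"
  shows "real (card (fixed_matrices n (False, 1, 1, a, b))) =
    2 powr (real n * real n / real (lcm (add_order n a) (add_order n b)))"
  using card_fixed_matrices_plain[OF n, of 1 1 a b] by (simp add: coordinate_period_def)

text \<open>In a row fixed by the reflection only the column shift by \<open>b\<close> acts, so the
  period is the order of \<open>b\<close>; any other row needs an even exponent to return, which
  brings in the lcm with 2.\<close>

lemma card_fixed_row_reflection:
  assumes n: "0 < n"
  shows "real (card (fixed_matrices n (False, -1, 1, a, b))) =
    2 powr (real n * (real (card (halves n a)) / real (add_order n b) +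
      (real n - real (card (halves n a))) / real (lcm 2 (add_order n b))))"
proof -
  have "(\<Sum>x<n. \<Sum>y<n. 1 / real (lcm (coordinate_period n (-1) a x) (coordinate_period n 1 b y))) =
    real n * (\<Sum>x<n. if x \<in> halves n a then 1 / real (add_order n b) else 1 / real (lcm 2 (add_order n b)))"
    unfolding sum_distrib_left by (rule sum.cong) (auto simp: coordinate_period_def)
  then show ?thesis
    using card_fixed_matrices_plain[OF n, of "-1" 1 a b] by (simp add: sum_if_halves)
qed

lemma card_fixed_column_reflection:
  assumes n: "0 < n"
  shows "card (fixed_matrices n (False, 1, -1, a, b)) = card (fixed_matrices n (False, -1, 1, b, a))"
proof -
  have "(\<Sum>x<n. \<Sum>y<n. 1 / real (lcm (coordinate_period n 1 a x) (coordinate_period n (-1) b y))) =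
    (\<Sum>x<n. \<Sum>y<n. 1 / real (lcm (coordinate_period n (-1) b x) (coordinate_period n 1 a y)))"
    by (subst sum.swap) (simp only: lcm.commute)
  then have "real (card (fixed_matrices n (False, 1, -1, a, b))) = real (card (fixed_matrices n (False, -1, 1, b, a)))"
    using card_fixed_matrices_plain[OF n, of 1 "-1" a b] card_fixed_matrices_plain[OF n, of "-1" 1 b a] by simp
  then show ?thesis by simp
qed

text \<open>Every position has period 2 except the fixed points, where a fixed row meets a fixed
  column; each of those adds a further 1/2 to the exponent.\<close>

lemma card_fixed_half_turn:
  assumes n: "0 < n"
  shows "real (card (fixed_matrices n (False, -1, -1, a, b))) =
    2 powr (real n * real n / 2 + real (card (halves n a)) * real (card (halves n b)) / 2)"
proof -
  define h where "h a x = (if x \<in> halves n a then 1 else 0 :: real)" for a x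
  have "(\<Sum>x<n. \<Sum>y<n. 1 / real (lcm (coordinate_period n (-1) a x) (coordinate_period n (-1) b y))) =
    (\<Sum>x<n. \<Sum>y<n. 1 / 2 + 1 / 2 * (h a x * h b y))"
    by (intro sum.cong) (auto simp: coordinate_period_def h_def)
  also have "\<dots> = real n * real n / 2 + 1 / 2 * ((\<Sum>x<n. h a x) * (\<Sum>y<n. h b y))"
    by (simp add: sum.distrib flip: sum_distrib_left sum_distrib_right sum_divide_distrib)
  also have "\<dots> = real n * real n / 2 + real (card (halves n a)) * real (card (halves n b)) / 2"
    by (simp add: h_def sum_if_halves)
  finally show ?thesis
    using card_fixed_matrices_plain[OF n, of "-1" "-1" a b] by simp
qed

section \<open>Transposing maps with equal signs: glide reflections along a diagonal\<close>

text \<open>The square of a glide reflection is the translation by \<open>(s, e * s)\<close>, a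
  vector parallel to the axis. Odd iterates follow by one more application.\<close>

lemma affine_map_diagonal_funpow:
  assumes e: "e * e = 1" and s: "s = a + e * b"
  shows "(affine_map (True, e, e, a, b) ^^ (2 * k)) (x, y) = (x + int k * s, y + e * (int k * s))"
proof (induction k)
  case (Suc k)
  have "(affine_map (True, e, e, a, b) ^^ (2 * Suc k)) (x, y) =
      affine_map (True, e, e, a, b) (affine_map (True, e, e, a, b) ((affine_map (True, e, e, a, b) ^^ (2 * k)) (x, y)))"
    by simp
  also have "\<dots> = (e * e * (x + int k * s) + e * b + a, e * e * (y + e * (int k * s)) + e * a + b)"
    by (simp only: Suc affine_map.simps if_True) (simp add: algebra_simps)
  also have "\<dots> = (x + int (Suc k) * s, y + e * (int (Suc k) * s))"
  proof -
    have "e * (e * b) = b" by (simp add: e flip: mult.assoc)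
    then show ?thesis unfolding e by (simp add: s algebra_simps)
  qed
  finally show ?case .
qed simp

text \<open>
  The iterate with exponent \<open>2j + 1\<close> can fix a point only if \<open>(2j + 1) s = 0\<close> modulo \<open>n\<close>. This
  forces the order of \<open>s\<close> to be odd, say \<open>2i + 1\<close>, and then \<open>j s = i s\<close> does not depend on \<open>j\<close>.
\<close>

lemma diagonal_period:
  fixes x y a b e :: int
  assumes n: "0 < n" and e: "e * e = 1" and s: "s = a + e * b" and o: "o' = add_order n s"
    and uv: "(affine_map (True, e, e, a, b) ^^ k) (x, y) = (u, v)"
  shows "[u = x] (mod int n) \<and> [v = y] (mod int n) \<longleftrightarrow>
    (if odd o' \<and> [x = e * y + (a + int (o' div 2) * s)] (mod int n) then o' else 2 * o') dvd k"
    (is "?L \<longleftrightarrow> ?N dvd k")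
proof -
  have ord: "int o' dvd j \<longleftrightarrow> int n dvd j * s" for j
    using add_order_dvd_iff[OF n] by (simp add: o)
  have o0: "0 < o'" using add_order_pos[OF n] by (simp add: o)
  consider j where "k = 2 * j" | j where "k = 2 * j + 1" by (metis oddE evenE)
  then show ?thesis
  proof cases
    case 1
    have eq: "u = x + int j * s" "v = y + e * (int j * s)"
      using uv unfolding 1 affine_map_diagonal_funpow[OF e s] by auto
    have "?L \<longleftrightarrow> int n dvd int j * s"
      by (auto simp: eq cong_iff_dvd_diff)
    also have "\<dots> \<longleftrightarrow> o' dvd j" using ord[of "int j"] by simp
    also have "\<dots> \<longleftrightarrow> ?N dvd k"
      using o0 by (auto simp: 1 coprime_dvd_mult_right_iff)
    finally show ?thesis .
  next
    case 2
    have eq: "u = e * y + int j * s + a" "v = e * x + e * (int j * s) + b"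
    proof -
      have "(u, v) = affine_map (True, e, e, a, b) (x + int j * s, y + e * (int j * s))"
        using uv unfolding 2 by (simp add: affine_map_diagonal_funpow[OF e s])
      moreover have "e * (e * (int j * s)) = int j * s" by (simp add: e flip: mult.assoc)
      ultimately show "u = e * y + int j * s + a" "v = e * x + e * (int j * s) + b"
        by (auto simp: algebra_simps)
    qed
    have dvd_e: "int n dvd e * z \<longleftrightarrow> int n dvd z" for z
      by (metis dvd_mult e mult.assoc mult_1)
    \<comment> \<open>As \<open>e\<close> is a unit, once the first coordinate has returned, the
      second returns iff \<open>n\<close> divides \<open>(2 * j + 1) * s\<close>.\<close>
    have v_eq: "v - y = e * ((2 * int j + 1) * s - (u - x))"
    proof -
      have "e * ((2 * int j + 1) * s - (u - x)) = e * (int j * s) + e * e * b - e * e * y + e * x"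
        by (simp add: eq s algebra_simps)
      then show ?thesis by (simp add: eq e)
    qed
    have "int n dvd A \<Longrightarrow> int n dvd B - A \<longleftrightarrow> int n dvd B" for A B
      by (metis diff_add_cancel dvd_add_left_iff)
    then have "?L \<longleftrightarrow> int n dvd (u - x) \<and> int n dvd (2 * int j + 1) * s"
      unfolding cong_iff_dvd_diff v_eq dvd_e by blast
    also have "\<dots> \<longleftrightarrow> int n dvd (u - x) \<and> int o' dvd 2 * int j + 1"
      by (simp only: ord)
    also have "\<dots> \<longleftrightarrow> int o' dvd 2 * int j + 1 \<and> odd o' \<and> [x = e * y + (a + int (o' div 2) * s)] (mod int n)"
    proof -
      have "odd o' \<and> (int n dvd (u - x) \<longleftrightarrow> [x = e * y + (a + int (o' div 2) * s)] (mod int n))"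
        if dvd: "int o' dvd 2 * int j + 1"
      proof -
        have odd: "odd o'"
        proof
          assume "even o'"
          then have "even (2 * int j + 1)" using dvd by (meson dvd_trans even_of_nat)
          then show False by simp
        qed
        then have "int o' = 2 * int (o' div 2) + 1" by (metis odd_two_times_div_two_succ of_nat_1 of_nat_add of_nat_mult of_nat_numeral)
        then have "2 * int j + 1 - int o' = 2 * (int j - int (o' div 2))" by simp
        then have "int o' dvd 2 * (int j - int (o' div 2))" using dvd by (metis dvd_diff dvd_refl)
        moreover have "coprime (int o') 2" using odd by simp
        ultimately have "int o' dvd int j - int (o' div 2)"
          using coprime_dvd_mult_right_iff by blast
        then have d: "int n dvd (int j - int (o' div 2)) * s" by (simp add: ord)
        have "u - x = (int j - int (o' div 2)) * s - (x - (e * y + (a + int (o' div 2) * s)))"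
          by (simp add: eq algebra_simps)
        then have "int n dvd (u - x) \<longleftrightarrow> int n dvd x - (e * y + (a + int (o' div 2) * s))"
          using d by (metis dvd_diff_right_iff)
        then show ?thesis using odd by (simp add: cong_iff_dvd_diff)
      qed
      then show ?thesis by blast
    qed
    also have "\<dots> \<longleftrightarrow> ?N dvd k"
    proof -
      have "int o' dvd 2 * int j + 1 \<longleftrightarrow> o' dvd k"
        using int_dvd_int_iff[of o' "2 * j + 1"] by (simp add: 2 add.commute)
      moreover have "\<not> 2 * o' dvd k" unfolding 2 by (metis dvd_mult_left even_plus_one_iff even_mult_iff even_numeral)
      ultimately show ?thesis by auto
    qed
    finally show ?thesis .
  qed
qed

lemma sum_if_residue_class:
  fixes u v :: real
  assumes "0 < n"
  shows "(\<Sum>x<n. if [int x = c] (mod int n) then u else v) = u + (real n - 1) * v"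
proof -
  have "(\<Sum>x<n. if [int x = c] (mod int n) then u else v) =
      (\<Sum>x<n. v + (if [int x = c] (mod int n) then u - v else 0))"
    by (rule sum.cong) auto
  also have "\<dots> = real n * v + real (card {x \<in> {..<n}. [int x = c] (mod int n)}) * (u - v)"
    by (simp add: sum.distrib sum.If_cases Int_def)
  finally show ?thesis
    by (simp only: card_residue_class[OF assms]) (simp add: algebra_simps)
qed

text \<open>If \<open>d\<close> is odd, each \<open>y\<close> has exactly one \<open>x\<close> with
  period \<open>d\<close>, and the exponent is \<open>n / d + n * (n - 1) / (2 * d)\<close>; this is
  why the sums are exchanged. If \<open>d\<close> is even, every period is
  \<open>2 * d\<close>.\<close>

lemma card_fixed_diagonal:
  assumes n: "0 < n" and e: "e * e = 1"
  shows "real (card (fixed_matrices n (True, e, e, a, b))) =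
    (let d = add_order n (a + e * b) in
      2 powr (real n * (real n + (if odd d then 1 else 0)) / (2 * real d)))"
proof -
  define s where "s = a + e * b"
  define d where "d = add_order n s"
  have d0: "0 < d" using add_order_pos[OF n] by (simp add: d_def)
  define N where "N x y = (if odd d \<and> [int x = e * int y + (a + int (d div 2) * s)] (mod int n) then d else 2 * d)" for x y
  have "(\<Sum>x<n. \<Sum>y<n. 1 / real (N x y)) = (\<Sum>y<n. \<Sum>x<n. 1 / real (N x y))"
    by (rule sum.swap)
  also have "\<dots> = real n * (real n + (if odd d then 1 else 0)) / (2 * real d)"
  proof (cases "odd d")
    case True
    have "(\<Sum>y<n. \<Sum>x<n. 1 / real (N x y)) = (\<Sum>y<n. 1 / real d + (real n - 1) * (1 / (2 * real d)))"
    proof (rule sum.cong[OF refl])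
      fix y
      show "(\<Sum>x<n. 1 / real (N x y)) = 1 / real d + (real n - 1) * (1 / (2 * real d))"
        unfolding sum_if_residue_class[OF n, of "e * int y + (a + int (d div 2) * s)", symmetric]
        by (rule sum.cong) (auto simp: N_def True)
    qed
    then show ?thesis using True d0 by (simp add: field_simps)
  next
    case False
    then have "N x y = 2 * d" for x y by (simp add: N_def)
    then show ?thesis using False by simp
  qed
  finally have sum: "(\<Sum>x<n. \<Sum>y<n. 1 / real (N x y)) = real n * (real n + (if odd d then 1 else 0)) / (2 * real d)" .
  have "real (card (fixed_matrices n (True, e, e, a, b))) = 2 powr (\<Sum>x<n. \<Sum>y<n. 1 / real (N x y))"
  proof (rule card_fixed_matrices[OF n])
    fix x y k u v
    assume "(affine_map (True, e, e, a, b) ^^ k) (int x, int y) = (u, v)"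
    from diagonal_period[OF n e s_def d_def this]
    show "[u = int x] (mod int n) \<and> [v = int y] (mod int n) \<longleftrightarrow> N x y dvd k"
      by (simp only: N_def)
  qed (use d0 in \<open>auto simp: N_def\<close>)
  then show ?thesis by (simp only: sum Let_def d_def s_def)
qed

section \<open>Transposing maps with opposite signs: quarter turns\<close>

text \<open>The square is the half turn to \<open>(a + e * b - x, b - e * a - y)\<close>, so the
  fourth power is the identity and only \<open>k mod 4\<close> matters. Fixed points are described
  by a condition on \<open>x\<close> and a formula for \<open>y\<close>, a form in which they are
  easily counted.\<close>

lemma quarter_turn_period:
  fixes x y a b e :: int
  assumes e: "e * e = 1"
    and uv: "(affine_map (True, e, - e, a, b) ^^ k) (x, y) = (u, v)"
  shows "[u = x] (mod int n) \<and> [v = y] (mod int n) \<longleftrightarrow>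
    (if [2 * x = a + e * b] (mod int n) \<and> [y = e * (x - a)] (mod int n) then 1
     else if [2 * x = a + e * b] (mod int n) \<and> [2 * y = b - e * a] (mod int n) then 2 else 4) dvd k"
    (is "?L \<longleftrightarrow> (if ?P1 then 1 else if ?P2 then 2 else 4) dvd k")
proof -
  let ?F = "affine_map (True, e, - e, a, b)"
  let ?n = "int n"
  have ee: "e * (e * z) = z" for z by (simp add: e flip: mult.assoc)
  have F2: "?F (?F (x, y)) = (a + e * b - x, b - e * a - y)" for x y
    by (simp add: algebra_simps ee e)
  have F_2: "(?F ^^ 2) (x, y) = (a + e * b - x, b - e * a - y)"
    by (simp add: numeral_2_eq_2 F2 del: affine_map.simps)
  have F_3: "(?F ^^ 3) (x, y) = (e * b - e * y, e * x - e * a)"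
    by (simp add: numeral_3_eq_3 F2 del: affine_map.simps) (simp add: algebra_simps ee e)
  have F4: "(?F ^^ 4) (x, y) = (x, y)"
    by (simp add: numeral_eq_Suc F2 del: affine_map.simps)
  have u: "(?F ^^ (k mod 4)) (x, y) = (u, v)"
    using uv funpow_mod_eq[OF F4, of k] by simp
  have P1: "?n dvd 2 * x - (a + e * b)" "?n dvd y - e * (x - a)"
    "?n dvd 2 * y - (b - e * a)" if ?P1
  proof -
    show 1: "?n dvd 2 * x - (a + e * b)" and 2: "?n dvd y - e * (x - a)"
      using that by (auto simp: cong_iff_dvd_diff)
    have eq: "2 * y - (b - e * a) = 2 * (y - e * (x - a)) + e * (2 * x - (a + e * b))"
      by (simp add: algebra_simps ee e)
    show "?n dvd 2 * y - (b - e * a)" unfolding eq by (intro dvd_add dvd_mult 1 2)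
  qed
  have "k mod 4 < 4" by simp
  then consider "k mod 4 = 0" | "k mod 4 = 1" | "k mod 4 = 2" | "k mod 4 = 3" by linarith
  then show ?thesis
  proof cases
    case 1
    then have "u = x" "v = y" using u by auto
    moreover have "4 dvd k" using 1 by presburger
    moreover have "2 dvd k" using 1 by presburger
    ultimately show ?thesis by simp
  next
    case 2
    then have uv: "u = e * y + a" "v = - e * x + b" using u by auto
    have "?L \<longleftrightarrow> ?P1"
    proof
      assume ?L
      then have L: "?n dvd e * y + a - x" "?n dvd - e * x + b - y"
        by (auto simp: uv cong_iff_dvd_diff)
      \<comment> \<open>Because \<open>e * e = 1\<close>, the two pairs of differences are integer
        combinations of each other, here and in the converse, so divisibility by \<open>n\<close>
        transfers.\<close>
      have eq: "2 * x - (a + e * b) = - 1 * (e * y + a - x) + - e * (- e * x + b - y)"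
        "y - e * (x - a) = e * (e * y + a - x)"
        by (simp_all add: algebra_simps ee e)
      show ?P1 unfolding cong_iff_dvd_diff eq by (intro conjI dvd_add dvd_mult L)
    next
      assume ?P1
      have eq: "u - x = e * (y - e * (x - a))" "v - y = - e * (2 * x - (a + e * b)) + - 1 * (y - e * (x - a))"
        by (simp_all add: uv algebra_simps ee e)
      show ?L unfolding cong_iff_dvd_diff eq by (intro conjI dvd_add dvd_mult P1[OF \<open>?P1\<close>])
    qed
    moreover have "\<not> 2 dvd k" using 2 by presburger
    moreover have "\<not> 4 dvd k" using 2 by presburger
    ultimately show ?thesis by simp
  next
    case 3
    then have uv: "u = a + e * b - x" "v = b - e * a - y"
      using u F_2 by simp_all
    have "?L \<longleftrightarrow> ?P2"
    proof -
      have "u - x = - (2 * x - (a + e * b))" "v - y = - (2 * y - (b - e * a))" by (simp_all add: uv)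
      then show ?thesis unfolding cong_iff_dvd_diff by (simp only: dvd_minus_iff)
    qed
    moreover have ?P2 if ?P1
      using that P1(3)[OF that] by (simp only: cong_iff_dvd_diff)
    moreover have "2 dvd k" using 3 by presburger
    moreover have "\<not> 4 dvd k" using 3 by presburger
    ultimately show ?thesis by auto
  next
    case 4
    then have uv: "u = e * b - e * y" "v = e * x - e * a"
      using u F_3 by simp_all
    \<comment> \<open>The third iterate is the inverse of the map, so it fixes the same
      points.\<close>
    have "?L \<longleftrightarrow> ?P1"
    proof
      assume ?L
      then have L: "?n dvd u - x" "?n dvd v - y"
        by (auto simp: cong_iff_dvd_diff)
      have eq: "2 * x - (a + e * b) = - 1 * (u - x) + e * (v - y)" "y - e * (x - a) = - 1 * (v - y)"
        by (simp_all add: uv algebra_simps ee e)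
      show ?P1 unfolding cong_iff_dvd_diff eq by (intro conjI dvd_add dvd_mult L)
    next
      assume ?P1
      have eq: "u - x = - 1 * (2 * x - (a + e * b)) + - e * (y - e * (x - a))" "v - y = - 1 * (y - e * (x - a))"
        by (simp_all add: uv algebra_simps ee e)
      show ?L unfolding cong_iff_dvd_diff eq by (intro conjI dvd_add dvd_mult P1[OF \<open>?P1\<close>])
    qed
    moreover have "\<not> 2 dvd k" using 4 by presburger
    moreover have "\<not> 4 dvd k" using 4 by presburger
    ultimately show ?thesis by simp
  qed
qed

text \<open>Since \<open>e\<close> is odd, the two arguments have the same parity, and the number of
  halves depends at most on that.\<close>

lemma card_halves_quarter_turn:
  assumes n: "0 < n" and e: "e * e = 1"
  shows "card (halves n (b - e * a)) = card (halves n (a + e * b))"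
proof (cases "odd n")
  case False
  have "odd e" using e by (metis even_mult_iff odd_one)
  then show ?thesis using False n by (simp add: card_halves_even)
qed (simp add: card_halves_odd)

text \<open>There are \<open>h\<close> fixed points, \<open>h * h - h\<close> points of period 2 and
  otherwise period 4, so the exponent is
  \<open>h + (h * h - h) / 2 + (n * n - h * h) / 4\<close>.\<close>

lemma card_fixed_quarter_turn:
  assumes n: "0 < n" and e: "e * e = 1"
  shows "real (card (fixed_matrices n (True, e, - e, a, b))) =
    (let h = real (card (halves n (a + e * b))) in 2 powr (h / 2 + h * h / 4 + real n * real n / 4))"
proof -
  define s where "s = a + e * b"
  define r where "r = b - e * a"
  define h where "h = real (card (halves n s))"
  define N :: "nat \<Rightarrow> nat \<Rightarrow> nat" where "N x y =
    (if x \<in> halves n s \<and> [int y = e * (int x - a)] (mod int n) then 1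
     else if x \<in> halves n s \<and> y \<in> halves n r then 2 else 4)" for x y
  define i where "i P = (if P then 1 else 0 :: real)" for P
  have fixed: "y \<in> halves n r" if "x \<in> halves n s" "[int y = e * (int x - a)] (mod int n)" "y < n" for x y
  proof -
    have "int n dvd 2 * int x - (a + e * b)" "int n dvd int y - e * (int x - a)"
      using that by (auto simp: halves_def s_def cong_iff_dvd_diff)
    moreover have "e * (e * b) = b" by (simp add: e flip: mult.assoc)
    then have eq: "2 * int y - (b - e * a) = 2 * (int y - e * (int x - a)) + e * (2 * int x - (a + e * b))"
      by (simp add: algebra_simps)
    ultimately have "int n dvd 2 * int y - (b - e * a)"
      unfolding eq by (intro dvd_add dvd_mult)
    then show ?thesis using that(3) by (simp add: halves_def r_def cong_iff_dvd_diff)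
  qed
  \<comment> \<open>By \<open>fixed\<close> the indicators nest, so the reciprocals 1/4, 1/2 and 1
    arise as 1/4, 1/4 + 1/4 and 1/4 + 1/4 + 1/2.\<close>
  have "(\<Sum>x<n. \<Sum>y<n. 1 / real (N x y)) = (\<Sum>x<n. \<Sum>y<n. 1 / 4 + 1 / 4 * (i (x \<in> halves n s) * i (y \<in> halves n r)) +
      1 / 2 * i (x \<in> halves n s) * i ([int y = e * (int x - a)] (mod int n)))"
    by (intro sum.cong) (auto simp: N_def i_def fixed)
  also have "\<dots> = real n * real n / 4 + 1 / 4 * ((\<Sum>x<n. i (x \<in> halves n s)) * (\<Sum>y<n. i (y \<in> halves n r))) +
      1 / 2 * (\<Sum>x<n. i (x \<in> halves n s) * (\<Sum>y<n. i ([int y = e * (int x - a)] (mod int n))))"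
    by (simp add: sum.distrib mult.assoc flip: sum_distrib_left sum_distrib_right sum_divide_distrib)
  also have "\<dots> = h / 2 + h * h / 4 + real n * real n / 4"
    using card_halves_quarter_turn[OF n e, of b a]
    by (simp add: i_def sum_if_halves sum_if_residue_class[OF n] h_def r_def s_def)
  finally have sum: "(\<Sum>x<n. \<Sum>y<n. 1 / real (N x y)) = h / 2 + h * h / 4 + real n * real n / 4" .
  have "real (card (fixed_matrices n (True, e, - e, a, b))) = 2 powr (\<Sum>x<n. \<Sum>y<n. 1 / real (N x y))"
  proof (rule card_fixed_matrices[OF n])
    fix x y k u v
    assume xy: "x < n" "y < n" and "(affine_map (True, e, - e, a, b) ^^ k) (int x, int y) = (u, v)"
    from quarter_turn_period[OF e this(3), of n] xy
    show "[u = int x] (mod int n) \<and> [v = int y] (mod int n) \<longleftrightarrow> N x y dvd k"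
      by (simp add: N_def halves_def s_def r_def)
  qed (auto simp: N_def)
  then show ?thesis by (simp only: sum Let_def h_def s_def)
qed

section \<open>Summation over the group\<close>

lemma sum_affine_parameters:
  fixes f :: "bool \<times> int \<times> int \<times> int \<times> int \<Rightarrow> real"
  shows "sum f (affine_parameters n) = (\<Sum>a\<in>{0..<int n}. \<Sum>b\<in>{0..<int n}.
    f (False, 1, 1, a, b) + f (False, -1, 1, a, b) + f (False, 1, -1, a, b) + f (False, -1, -1, a, b) +
    f (True, 1, 1, a, b) + f (True, -1, -1, a, b) + f (True, 1, -1, a, b) + f (True, -1, 1, a, b))"
proof -
  have "sum f (affine_parameters n) = (\<Sum>t\<in>UNIV. \<Sum>e\<in>{1, -1}. \<Sum>d\<in>{1, -1}.
      \<Sum>a\<in>{0..<int n}. \<Sum>b\<in>{0..<int n}. f (t, e, d, a, b))"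
    by (simp only: affine_parameters_def sum.cartesian_product case_prod_unfold prod.collapse)
  then show ?thesis
    by (simp add: UNIV_bool sum.distrib)
qed

lemma sum_fixed_translations:
  assumes n: "0 < n"
  shows "(\<Sum>a\<in>{0..<int n}. \<Sum>b\<in>{0..<int n}. real (card (fixed_matrices n (False, 1, 1, a, b)))) =
    4 * real n * real n * b1 n n"
proof -
  have "(\<Sum>a\<in>{0..<int n}. \<Sum>b\<in>{0..<int n}. real (card (fixed_matrices n (False, 1, 1, a, b)))) =
    (\<Sum>a\<in>{0..<int n}. \<Sum>d | d dvd n. real (totient d) * 2 powr (real n * real n / real (lcm (add_order n a) d)))"
    unfolding card_fixed_translation[OF n]
    by (intro sum.cong refl sum_add_order[OF n, where g = "\<lambda>d. 2 powr (real n * real n / real (lcm (add_order n _) d))"])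
  also have "\<dots> = (\<Sum>c | c dvd n. real (totient c) *
      (\<Sum>d | d dvd n. real (totient d) * 2 powr (real n * real n / real (lcm c d))))"
    by (rule sum_add_order[OF n])
  also have "\<dots> = 4 * real n * real n * b1 n n"
    using n by (simp add: b1_def sum_distrib_left mult.assoc)
  finally show ?thesis .
qed

lemma sum_odd_divisors:
  fixes f :: "nat \<Rightarrow> real"
  assumes "0 < n"
  shows "(\<Sum>d | d dvd n \<and> odd d. f d) = (\<Sum>d | d dvd n. if odd d then f d else 0)"
  using assms sum.inter_filter[of "{d. d dvd n}" f odd] by simp

text \<open>An even \<open>d\<close> absorbs the 2 in the lcm, so fixed rows make no difference and
  the first sum of \<open>b2\<close> is right; the second sum of \<open>b2\<close> corrects the
  terms with odd \<open>d\<close>, where the lcm is \<open>2 * d\<close>.\<close>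

lemma sum_fixed_row_reflections:
  assumes n: "0 < n"
  shows "(\<Sum>a\<in>{0..<int n}. \<Sum>b\<in>{0..<int n}. real (card (fixed_matrices n (False, -1, 1, a, b)))) =
    4 * real n * real n * b2 n n"
proof -
  define f where "f h d = 2 powr (real n * (real h / real d + (real n - real h) / real (lcm 2 d)))" for h d
  have "(\<Sum>a\<in>{0..<int n}. \<Sum>b\<in>{0..<int n}. real (card (fixed_matrices n (False, -1, 1, a, b)))) =
    (\<Sum>a\<in>{0..<int n}. \<Sum>d | d dvd n. real (totient d) * f (card (halves n a)) d)"
    unfolding card_fixed_row_reflection[OF n] f_def[symmetric]
    by (intro sum.cong refl sum_add_order[OF n])
  also have "\<dots> = (\<Sum>d | d dvd n. real (totient d) * (\<Sum>a\<in>{0..<int n}. f (card (halves n a)) d))"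
    by (subst sum.swap) (simp only: sum_distrib_left)
  also have "\<dots> = (\<Sum>d | d dvd n. real (totient d) *
      (if odd n then real n * f 1 d else real n / 2 * (f 0 d + f 2 d)))"
    by (simp only: sum_card_halves[OF n, of "\<lambda>h. f h _"])
  also have "\<dots> = 4 * real n * real n * b2 n n"
  proof (cases "odd n")
    case True
    have "f 1 d = 2 powr ((real n + 1) * real n / (2 * real d))" if "d dvd n" for d
    proof -
      have "odd d" "0 < d" using that True n by (auto intro!: Nat.gr0I)
      then have "lcm 2 d = 2 * d" by (simp add: lcm_coprime)
      then have "real n * (1 / real d + (real n - 1) / real (lcm 2 d)) = (real n + 1) * real n / (2 * real d)"
        using \<open>0 < d\<close> by (simp add: field_simps)
      then show ?thesis by (simp add: f_def)
    qed
    then have "(\<Sum>d | d dvd n. real (totient d) * (real n * f 1 d)) =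
        real n * (\<Sum>d | d dvd n. real (totient d) * 2 powr ((real n + 1) * real n / (2 * real d)))"
      unfolding sum_distrib_left by (intro sum.cong) auto
    \<comment> \<open>All divisors being odd, the subtracted powers in \<open>b2\<close> cancel its
      whole first sum.\<close>
    moreover have "{d. d dvd n \<and> odd d} = {d. d dvd n}" using True by auto
    then have "4 * real n * b2 n n = (\<Sum>d | d dvd n. real (totient d) * 2 powr ((real n + 1) * real n / (2 * real d)))"
      using True n by (simp add: b2_def field_simps sum_subtractf)
    ultimately show ?thesis using True by simp
  next
    case False
    have "f 0 d + f 2 d = 2 * 2 powr (real n * real n / real d) +
      (if odd d then 2 powr (real n * real n / (2 * real d)) +
        2 powr ((real n + 2) * real n / (2 * real d)) - 2 * 2 powr (real n * real n / real d) else 0)"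
      if "d dvd n" for d
    proof (cases "odd d")
      case True
      have "0 < d" using that n by (auto intro!: Nat.gr0I)
      have "lcm 2 d = 2 * d" using True by (simp add: lcm_coprime)
      then have "real n * (0 / real d + (real n - 0) / real (lcm 2 d)) = real n * real n / (2 * real d)"
        "real n * (2 / real d + (real n - 2) / real (lcm 2 d)) = (real n + 2) * real n / (2 * real d)"
        using \<open>0 < d\<close> by (simp_all add: field_simps)
      then show ?thesis using True unfolding f_def by (simp only: of_nat_0 of_nat_numeral if_True) simp
    next
      case False
      have "0 < d" using that n by (auto intro!: Nat.gr0I)
      have "lcm 2 d = d" using False by (simp add: lcm_proj2_if_dvd)
      then have "real n * (0 / real d + (real n - 0) / real (lcm 2 d)) = real n * real n / real d"
        "real n * (2 / real d + (real n - 2) / real (lcm 2 d)) = real n * real n / real d"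
        using \<open>0 < d\<close> by (simp_all add: field_simps)
      then show ?thesis using False unfolding f_def by (simp only: of_nat_0 of_nat_numeral if_False)
    qed
    then have "(\<Sum>d | d dvd n. real (totient d) * (real n / 2 * (f 0 d + f 2 d))) =
      (\<Sum>d | d dvd n. real n * (real (totient d) * 2 powr (real n * real n / real d)) +
        real n / 2 * (if odd d then real (totient d) * (2 powr (real n * real n / (2 * real d)) +
        2 powr ((real n + 2) * real n / (2 * real d)) - 2 * 2 powr (real n * real n / real d)) else 0))"
      by (intro sum.cong) (auto simp: algebra_simps)
    also have "\<dots> =
      real n * (\<Sum>d | d dvd n. real (totient d) * 2 powr (real n * real n / real d)) +
      real n / 2 * (\<Sum>d | d dvd n \<and> odd d. real (totient d) * (2 powr (real n * real n / (2 * real d)) +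
        2 powr ((real n + 2) * real n / (2 * real d)) - 2 * 2 powr (real n * real n / real d)))"
      by (simp only: sum_odd_divisors[OF n] sum.distrib sum_distrib_left)
    finally show ?thesis
      using False n by (simp add: b2_def distrib_left)
  qed
  finally show ?thesis .
qed

text \<open>For even \<open>n\<close> the pairs of counts (0, 0), (0, 2), (2, 0), (2, 2) are equally
  frequent, and only the last adds 2 to the exponent. The weights 1 + 1 + 1 + 4 are the 7 of
  \<open>b4\<close>.\<close>

lemma sum_fixed_half_turns:
  assumes n: "0 < n"
  shows "(\<Sum>a\<in>{0..<int n}. \<Sum>b\<in>{0..<int n}. real (card (fixed_matrices n (False, -1, -1, a, b)))) =
    4 * real n * real n * b4 n n"
proof -
  define f where "f h h' = 2 powr (real n * real n / 2 + real h * real h' / 2)" for h h'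
  define g where "g h = (if odd n then real n * f h 1 else real n / 2 * (f h 0 + f h 2))" for h
  have "(\<Sum>a\<in>{0..<int n}. \<Sum>b\<in>{0..<int n}. real (card (fixed_matrices n (False, -1, -1, a, b)))) =
    (\<Sum>a\<in>{0..<int n}. g (card (halves n a)))"
    unfolding card_fixed_half_turn[OF n] f_def[symmetric] g_def
    by (intro sum.cong refl sum_card_halves[OF n])
  also have "\<dots> = (if odd n then real n * g 1 else real n / 2 * (g 0 + g 2))"
    by (rule sum_card_halves[OF n])
  also have "\<dots> = 4 * real n * real n * b4 n n"
  proof (cases "odd n")
    case True
    have "f 1 1 = 2 powr (real n * real n / 2 + 1 / 2)" by (simp add: f_def)
    also have "\<dots> = 2 powr ((real n * real n - 3) / 2 + 2)"
      by (simp add: field_simps)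
    also have "\<dots> = 4 * 2 powr ((real n * real n - 3) / 2)"
      by (simp add: powr_add)
    finally show ?thesis using True by (simp add: b4_def g_def)
  next
    case False
    have "2 powr (real n * real n / 2) = 2 powr (real n * real n / 2 - 4 + 4)" by simp
    also have "\<dots> = 16 * 2 powr (real n * real n / 2 - 4)"
      unfolding powr_add by (simp add: powr_numeral)
    finally have "f 0 0 = 16 * 2 powr (real n * real n / 2 - 4)" "f 0 2 = f 0 0" "f 2 0 = f 0 0" "f 2 2 = 4 * f 0 0"
      by (simp_all add: f_def powr_add)
    then show ?thesis using False by (simp add: b4_def g_def)
  qed
  finally show ?thesis .
qed

text \<open>For fixed \<open>b\<close> the value \<open>a + e * b\<close> runs through all residues,
  so the sum over \<open>b\<close> only contributes a factor \<open>n\<close>.\<close>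

lemma sum_fixed_diagonals:
  assumes n: "0 < n" and e: "e * e = 1"
  shows "(\<Sum>a\<in>{0..<int n}. \<Sum>b\<in>{0..<int n}. real (card (fixed_matrices n (True, e, e, a, b)))) =
    real n * (\<Sum>d | d dvd n. real (totient d) *
      2 powr (real n * (real n + real d - 2 * real_of_int \<lfloor>real d / 2\<rfloor>) / (2 * real d)))"
proof -
  define f where "f d = 2 powr (real n * (real n + (if odd d then 1 else 0)) / (2 * real d))" for d :: nat
  have "(\<Sum>a\<in>{0..<int n}. \<Sum>b\<in>{0..<int n}. real (card (fixed_matrices n (True, e, e, a, b)))) =
    (\<Sum>b\<in>{0..<int n}. \<Sum>a\<in>{0..<int n}. f (add_order n (a + e * b)))"
    by (subst sum.swap) (simp only: card_fixed_diagonal[OF n e] Let_def f_def)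
  also have "\<dots> = (\<Sum>b\<in>{0..<int n}. \<Sum>a\<in>{0..<int n}. f (add_order n a))"
    by (rule sum.cong[OF refl], rule sum_periodic_shift[OF n, of "\<lambda>a. f (add_order n a)"])
      (simp add: add_order_cong)
  also have "\<dots> = real n * (\<Sum>d | d dvd n. real (totient d) * f d)"
    by (simp add: sum_add_order[OF n, of f])
  also have "(\<Sum>d | d dvd n. real (totient d) * f d) = (\<Sum>d | d dvd n. real (totient d) *
      2 powr (real n * (real n + real d - 2 * real_of_int \<lfloor>real d / 2\<rfloor>) / (2 * real d)))"
  proof (rule sum.cong[OF refl])
    fix d
    \<comment> \<open>\<open>d - 2 * \<lfloor>d / 2\<rfloor>\<close> is \<open>d mod 2\<close>,
      which is the parity indicator in \<open>f\<close>.\<close>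
    have "real_of_int \<lfloor>real d / 2\<rfloor> = real (d div 2)"
      using floor_divide_of_nat_eq[of d 2, where ?'a = real] by simp
    moreover have "real d = 2 * real (d div 2) + (if odd d then 1 else 0)"
      by (cases "odd d") (auto elim!: oddE evenE)
    ultimately show "real (totient d) * f d = real (totient d) *
        2 powr (real n * (real n + real d - 2 * real_of_int \<lfloor>real d / 2\<rfloor>) / (2 * real d))"
      by (simp add: f_def)
  qed
  finally show ?thesis .
qed

text \<open>For even \<open>n\<close> the count \<open>h\<close> is 0 or 2 equally often, and
  \<open>h / 2 + h * h / 4\<close> is then 0 or 2; the weights 1 + 4 make the 5. For odd
  \<open>n\<close> it is 3/4, and \<open>(n * n + 3) / 4 = (n * n - 5) / 4 + 2\<close>.\<close>

lemma sum_fixed_quarter_turns: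
  assumes n: "0 < n" and e: "e * e = 1"
  shows "(\<Sum>a\<in>{0..<int n}. \<Sum>b\<in>{0..<int n}. real (card (fixed_matrices n (True, e, - e, a, b)))) =
    4 * real n * real n * (if odd n then 2 powr (((real n)\<^sup>2 - 5) / 4) else 5 * 2 powr ((real n)\<^sup>2 / 4 - 3))"
proof -
  define f where "f h = 2 powr (real h / 2 + real h * real h / 4 + real n * real n / 4)" for h :: nat
  have "(\<Sum>a\<in>{0..<int n}. \<Sum>b\<in>{0..<int n}. real (card (fixed_matrices n (True, e, - e, a, b)))) =
    (\<Sum>b\<in>{0..<int n}. \<Sum>a\<in>{0..<int n}. f (card (halves n (a + e * b))))"
    by (subst sum.swap) (simp only: card_fixed_quarter_turn[OF n e] Let_def f_def)
  also have "\<dots> = (\<Sum>b\<in>{0..<int n}. \<Sum>a\<in>{0..<int n}. f (card (halves n a)))"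
    by (rule sum.cong[OF refl], rule sum_periodic_shift[OF n, of "\<lambda>a. f (card (halves n a))"])
      (simp only: card_halves_cong)
  also have "\<dots> = real n * (if odd n then real n * f 1 else real n / 2 * (f 0 + f 2))"
    by (simp add: sum_card_halves[OF n, of f])
  also have "\<dots> = 4 * real n * real n *
      (if odd n then 2 powr (((real n)\<^sup>2 - 5) / 4) else 5 * 2 powr ((real n)\<^sup>2 / 4 - 3))"
  proof (cases "odd n")
    case True
    have "f 1 = 2 powr (((real n)\<^sup>2 - 5) / 4 + 2)"
      by (simp add: f_def field_simps power2_eq_square)
    also have "\<dots> = 4 * 2 powr (((real n)\<^sup>2 - 5) / 4)"
      by (simp add: powr_add)
    finally show ?thesis using True by simp
  next
    case False
    have "2 powr (real n * real n / 4) = 2 powr ((real n)\<^sup>2 / 4 - 3 + 3)"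
      by (simp add: power2_eq_square)
    also have "\<dots> = 8 * 2 powr ((real n)\<^sup>2 / 4 - 3)"
      unfolding powr_add by (simp add: powr_numeral)
    finally have "f 0 = 8 * 2 powr ((real n)\<^sup>2 / 4 - 3)" "f 2 = 4 * f 0"
      by (simp_all add: f_def powr_add)
    then show ?thesis using False by simp
  qed
  finally show ?thesis .
qed

theorem theorem2:
  fixes n :: nat
  assumes "n \<ge> 1"
  shows "real (toroidal_beta n) =
    1 / 2 * toroidal_b n n
    + 1 / (4 * real n) * (\<Sum>d | d dvd n. real (totient d) *
        2 powr (real n * (real n + real d - 2 * real_of_int \<lfloor>real d / 2\<rfloor>) / (2 * real d)))
    + (if odd n then 2 powr (((real n)\<^sup>2 - 5) / 4) else 5 * 2 powr ((real n)\<^sup>2 / 4 - 3))"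
proof -
  have n: "0 < n" using assms by simp
  define S where "S = (\<Sum>d | d dvd n. real (totient d) *
    2 powr (real n * (real n + real d - 2 * real_of_int \<lfloor>real d / 2\<rfloor>) / (2 * real d)))"
  define q where "q = (if odd n then 2 powr (((real n)\<^sup>2 - 5) / 4) else 5 * 2 powr ((real n)\<^sup>2 / 4 - 3))"
  define F where "F t e d = (\<Sum>a\<in>{0..<int n}. \<Sum>b\<in>{0..<int n}. real (card (fixed_matrices n (t, e, d, a, b))))" for t e d
  have plain: "F False 1 1 = 4 * real n * real n * b1 n n" "F False (-1) 1 = 4 * real n * real n * b2 n n"
    "F False (-1) (-1) = 4 * real n * real n * b4 n n"
    by (simp_all only: F_def sum_fixed_translations[OF n] sum_fixed_row_reflections[OF n] sum_fixed_half_turns[OF n])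
  \<comment> \<open>Passing from column to row reflections exchanges the offsets, which exchanging
    the sums undoes; this is the term \<open>b3 n n\<close>, equal to \<open>b2 n n\<close>.\<close>
  have columns: "F False 1 (-1) = F False (-1) 1"
    unfolding F_def by (subst sum.swap) (simp only: card_fixed_column_reflection[OF n])
  have diagonal: "F True 1 1 = real n * S" "F True (-1) (-1) = real n * S"
    using sum_fixed_diagonals[OF n, of 1] sum_fixed_diagonals[OF n, of "-1"]
    by (simp_all add: F_def S_def)
  have quarter: "F True 1 (-1) = 4 * real n * real n * q" "F True (-1) 1 = 4 * real n * real n * q"
    using sum_fixed_quarter_turns[OF n, of 1] sum_fixed_quarter_turns[OF n, of "-1"]
    by (simp_all add: F_def q_def)
  have "real (toroidal_beta n) * (8 * real n * real n) = (\<Sum>p\<in>affine_parameters n. real (card (fixed_matrices n p)))"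
    unfolding of_nat_sum[symmetric] toroidal_beta_burnside[OF n, symmetric] by (simp add: power2_eq_square)
  also have "\<dots> = F False 1 1 + F False (-1) 1 + F False 1 (-1) + F False (-1) (-1) +
      F True 1 1 + F True (-1) (-1) + F True 1 (-1) + F True (-1) 1"
    by (simp only: sum_affine_parameters sum.distrib F_def)
  \<comment> \<open>The eight families add up to
    \<open>4 * n * n * toroidal_b n n + 2 * n * S + 8 * n * n * q\<close>.\<close>
  also have "\<dots> = (8 * real n * real n) * (1 / 2 * toroidal_b n n + 1 / (4 * real n) * S + q)"
    using n by (simp add: plain columns diagonal quarter toroidal_b_def b3_def field_simps)
  finally have "real (toroidal_beta n) = 1 / 2 * toroidal_b n n + 1 / (4 * real n) * S + q"
    using n by simp
  then show ?thesis unfolding S_def q_def .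
qed

end
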